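(* Let $(A,\{\cdot,\cdot\})$ be a polynomial Poisson algebra with basis $\{x_i\}_{i\in\mathcal I}$ over a field $\mathbb F$ of characteristic $0$, let $X_{ij}=\{x_i,x_j\}$ and $\pi_1=\frac12\{\cdot,\cdot\}=\frac12X_{ij}\,\partial^i\otimes\partial^j$. Then the following formula gives a third order deformation $\pi_\star=\pi+h\pi_1+h^2\pi_2+h^3\pi_3$ of $A$: $$\begin{aligned} \pi_\star=\pi&+\frac h2X_{ij}\partial^i\otimes\partial^j+\frac{h^2}{24}\Big[2X_{ij}^lX_{lk}(\partial^i\otimes\partial^{jk}+\partial^{jk}\otimes\partial^i)+3X_{ij}X_{kl}\partial^{ik}\otimes\partial^{jl}\Big]\\ &+\frac{h^3}{48}\Big[2X_{ij}X_{kl}^iX_{mn}^{jk}(\partial^n\otimes\partial^{lm}-\partial^{lm}\otimes\partial^n)+X_{ij}X_{kl}X_{mn}\partial^{ikm}\otimes\partial^{jln}\\ &\qquad+X_{lm}^kX_{jn}^lX_{ki}(\partial^{mn}\otimes\partial^{ij}-\partial^{ij}\otimes\partial^{mn})\\ &\qquad+X_{mn}^{kl}X_{lj}X_{ki}(\partial^m\otimes\partial^{nij}-\partial^{nij}\otimes\partial^m)\\ &\qquad+2X_{ij}^kX_{kl}X_{mn}(\partial^{jlm}\otimes\partial^{in}-\partial^{in}\otimes\partial^{jlm})\Big]. \end{aligned}$$ Up to equivalence, every extension of $\pi+h\pi_1$ to a third order deformation is of the form $$\pi+h\pi_1+h^2(\pi_2+\varphi_2)+h^3(\pi_3+\varphi_3+\psi_3)$$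 with $\varphi_2$ and $\varphi_3$ antisymmetric biderivations and $\psi_3$ a symmetric 2-cochain satisfying $\delta\psi_3=[\pi_1,\varphi_2]$. Conversely, for any such $\varphi_2,\varphi_3,\psi_3$ this is a third order deformation.
   Context: $A=\mathbb F[x_i]_{i\in\mathcal I}$ with product $\pi$; a Poisson bracket on $A$ is an antisymmetric biderivation satisfying the Jacobi identity. Repeated indices are summed over $\mathcal I$ (summation convention). Superscripts denote partial derivatives: $\partial^i=\partial/\partial x_i$, $\partial^{ij\cdots}=\partial^i\partial^j\cdots$, and $X_{ij}^{kl\cdots}=\partial^{kl\cdots}X_{ij}$. For differential operators, $(p\,\partial^I\otimes\partial^J)(f,g)=p\,\partial^I(f)\,\partial^J(g)$. A 2-cochain is an $\mathbb F$-bilinear map $A\times A\to A$. An $n$-th order deformation is a product $\pi+h\pi_1+\cdots+h^n\pi_n$ on $A[[h]]$, with 2-cochains $\pi_i$ extended $\mathbb F[[h]]$-bilinearly, which is associative modulo $h^{n+1}$. Two $n$-th order deformations $\pi_\star,\pi_\star'$ are equivalent if there is an $\mathbb F[[h]]$-linear map $F:A[[h]]\to A[[h]]$ with $F(p)=p\bmod h$ and $F(\pi_\star(p,q))=\pi'_\star(F(p),F(q))\bmod h^{n+1}$ for all $p,q\in A$. For 2-cochains $\varphi,\psi$: $[\varphi,\psi](p,q,r)=\varphi(\psi(p,q),r)-\varphi(p,\psi(q,r))+\psi(\varphi(p,q),r)-\psi(p,\varphi(q,r))$, and $\delta\varphi(p,q,r)=p\varphi(q,r)-\varphi(pq,r)+\varphi(p,qr)-\varphi(p,q)r$.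 *)

theory Defs
  imports
    "HOL-Library.Poly_Mapping"
    "HOL-Computational_Algebra.Formal_Power_Series"
begin

text \<open>
  The polynomial algebra over \<open>'f\<close> with one generator for each element of the type \<open>'i\<close>
  (which may be infinite): an exponent vector \<open>'i \<Rightarrow>\<^sub>0 nat\<close> is mapped to its coefficient.
  The ring structure is the convolution product provided by \<^theory>\<open>HOL-Library.Poly_Mapping\<close>.
\<close>

type_synonym ('i, 'f) mpoly = "('i \<Rightarrow>\<^sub>0 nat) \<Rightarrow>\<^sub>0 'f"

type_synonym ('i, 'f) cochain2 = "('i, 'f) mpoly \<Rightarrow> ('i, 'f) mpoly \<Rightarrow> ('i, 'f) mpoly"

definition gen :: "'i \<Rightarrow> ('i, 'f::field_char_0) mpoly" where
  "gen i = Poly_Mapping.single (Poly_Mapping.single i 1) 1"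

definition smul :: "'f \<Rightarrow> ('i, 'f) mpoly \<Rightarrow> ('i, 'f::field_char_0) mpoly" where
  "smul c p = Poly_Mapping.single 0 c * p"

text \<open>In the next definition the truncated subtraction is harmless: monomials in which
  \<open>gen i\<close> does not occur get the coefficient 0.\<close>

definition pderiv_var :: "'i \<Rightarrow> ('i, 'f) mpoly \<Rightarrow> ('i, 'f::field_char_0) mpoly" where
  "pderiv_var i p =
     (\<Sum>m\<in>Poly_Mapping.keys p.
        Poly_Mapping.single (m - Poly_Mapping.single i 1)
          (of_nat (Poly_Mapping.lookup m i) * Poly_Mapping.lookup p m))"

definition D :: "'i list \<Rightarrow> ('i, 'f) mpoly \<Rightarrow> ('i, 'f::field_char_0) mpoly" where
  "D is p = foldr pderiv_var is p"

text \<open>The operator written \<open>\<partial>\<^sup>I \<otimes> \<partial>\<^sup>J\<close> on paper.\<close>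

definition DD :: "'i list \<Rightarrow> 'i list \<Rightarrow> ('i, 'f::field_char_0) cochain2" where
  "DD is js = (\<lambda>p q. D is p * D js q)"


subsection \<open>Cochains and Poisson brackets\<close>

definition is_cochain2 :: "('i, 'f::field_char_0) cochain2 \<Rightarrow> bool" where
  "is_cochain2 \<phi> \<longleftrightarrow>
     (\<forall>p. module_hom smul smul (\<lambda>q. \<phi> p q)) \<and> (\<forall>q. module_hom smul smul (\<lambda>p. \<phi> p q))"

definition symmetric :: "('i, 'f::field_char_0) cochain2 \<Rightarrow> bool" where
  "symmetric \<phi> \<longleftrightarrow> (\<forall>p q. \<phi> p q = \<phi> q p)"

definition antisymmetric :: "('i, 'f::field_char_0) cochain2 \<Rightarrow> bool" where
  "antisymmetric \<phi> \<longleftrightarrow> (\<forall>p q. \<phi> p q = - \<phi> q p)"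

definition biderivation :: "('i, 'f::field_char_0) cochain2 \<Rightarrow> bool" where
  "biderivation \<phi> \<longleftrightarrow> is_cochain2 \<phi> \<and>
     (\<forall>p q r. \<phi> (p * q) r = p * \<phi> q r + \<phi> p r * q) \<and>
     (\<forall>p q r. \<phi> p (q * r) = q * \<phi> p r + \<phi> p q * r)"

definition poisson_bracket :: "('i, 'f::field_char_0) cochain2 \<Rightarrow> bool" where
  "poisson_bracket B \<longleftrightarrow> antisymmetric B \<and> biderivation B \<and>
     (\<forall>p q r. B p (B q r) + B q (B r p) + B r (B p q) = 0)"

definition gbracket :: "('i, 'f) cochain2 \<Rightarrow> ('i, 'f) cochain2 \<Rightarrow>
    ('i, 'f) mpoly \<Rightarrow> ('i, 'f) mpoly \<Rightarrow> ('i, 'f) mpoly \<Rightarrow> ('i, 'f::field_char_0) mpoly" where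
  "gbracket \<phi> \<psi> p q r =
     \<phi> (\<psi> p q) r - \<phi> p (\<psi> q r) + \<psi> (\<phi> p q) r - \<psi> p (\<phi> q r)"

definition hochschild :: "('i, 'f) cochain2 \<Rightarrow>
    ('i, 'f) mpoly \<Rightarrow> ('i, 'f) mpoly \<Rightarrow> ('i, 'f) mpoly \<Rightarrow> ('i, 'f::field_char_0) mpoly" where
  "hochschild \<phi> p q r = p * \<phi> q r - \<phi> (p * q) r + \<phi> p (q * r) - \<phi> p q * r"


subsection \<open>Deformations\<close>

text \<open>The \<open>F[[h]]\<close>-module structure of \<open>A[[h]]\<close>; the indeterminate \<open>h\<close> is \<^const>\<open>fps_X\<close>.\<close>

definition hsmul :: "'f fps \<Rightarrow> ('i, 'f) mpoly fps \<Rightarrow> ('i, 'f::field_char_0) mpoly fps" where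
  "hsmul c a = Abs_fps (\<lambda>n. Poly_Mapping.single 0 (fps_nth c n)) * a"

definition hcong :: "nat \<Rightarrow> ('i, 'f) mpoly fps \<Rightarrow> ('i, 'f::field_char_0) mpoly fps \<Rightarrow> bool" where
  "hcong n a b \<longleftrightarrow> fps_X ^ n dvd a - b"

text \<open>
  The \<open>F[[h]]\<close>-bilinear extension of a 2-cochain to \<open>A[[h]]\<close>.  It is unique: an \<open>F[[h]]\<close>-linear
  map preserves divisibility by \<open>h\<^sup>n\<close>, hence is determined by its values on \<open>A\<close>.
\<close>

definition hext :: "('i, 'f) cochain2 \<Rightarrow>
    ('i, 'f) mpoly fps \<Rightarrow> ('i, 'f) mpoly fps \<Rightarrow> ('i, 'f::field_char_0) mpoly fps" where
  "hext \<phi> a b = Abs_fps (\<lambda>n. \<Sum>k\<le>n. \<phi> (fps_nth a k) (fps_nth b (n - k)))"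

text \<open>The list \<open>[\<phi>\<^sub>0, \<phi>\<^sub>1, \<dots>, \<phi>\<^sub>n]\<close> stands for the product \<open>\<phi>\<^sub>0 + h \<phi>\<^sub>1 + \<dots> + h\<^sup>n \<phi>\<^sub>n\<close>.\<close>

definition star :: "('i, 'f) cochain2 list \<Rightarrow>
    ('i, 'f) mpoly fps \<Rightarrow> ('i, 'f) mpoly fps \<Rightarrow> ('i, 'f::field_char_0) mpoly fps" where
  "star \<phi>s a b = (\<Sum>k<length \<phi>s. fps_X ^ k * hext (\<phi>s ! k) a b)"

definition deformation :: "nat \<Rightarrow> ('i, 'f::field_char_0) cochain2 list \<Rightarrow> bool" where
  "deformation n \<phi>s \<longleftrightarrow>
     length \<phi>s = n + 1 \<and> \<phi>s ! 0 = (*) \<and> (\<forall>\<phi>\<in>set \<phi>s. is_cochain2 \<phi>) \<and>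
     (\<forall>a b c. hcong (n + 1) (star \<phi>s (star \<phi>s a b) c) (star \<phi>s a (star \<phi>s b c)))"

definition equivalent_deformations ::
    "nat \<Rightarrow> ('i, 'f) cochain2 list \<Rightarrow> ('i, 'f::field_char_0) cochain2 list \<Rightarrow> bool" where
  "equivalent_deformations n \<phi>s \<psi>s \<longleftrightarrow>
     deformation n \<phi>s \<and> deformation n \<psi>s \<and>
     (\<exists>F. module_hom hsmul hsmul F \<and>
        (\<forall>p. hcong 1 (F (fps_const p)) (fps_const p)) \<and>
        (\<forall>p q. hcong (n + 1)
           (F (star \<phi>s (fps_const p) (fps_const q)))
           (star \<psi>s (F (fps_const p)) (F (fps_const q)))))"


subsection \<open>The explicit formula\<close>

text \<open>
  \<open>X i j\<close> is the bracket of the generators \<open>i\<close> and \<open>j\<close>.  \<^const>\<open>Sum_any\<close> sums over all index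
  tuples with a nonzero summand.  There are only finitely many of these even if \<open>'i\<close> is infinite,
  since a polynomial has only finitely many nonzero partial derivatives of any given order and
  every index is bound, directly or through other indices, by a derivative of \<open>p\<close>, \<open>q\<close> or some \<open>X i j\<close>.
\<close>

definition pi1 :: "('i \<Rightarrow> 'i \<Rightarrow> ('i, 'f) mpoly) \<Rightarrow> ('i, 'f::field_char_0) cochain2" where
  "pi1 X p q = smul (1/2) (Sum_any (\<lambda>(i, j). X i j * DD [i] [j] p q))"

definition pi2 :: "('i \<Rightarrow> 'i \<Rightarrow> ('i, 'f) mpoly) \<Rightarrow> ('i, 'f::field_char_0) cochain2" where
  "pi2 X p q = smul (1/24)
     (2 * Sum_any (\<lambda>(i, j, k, l). D [l] (X i j) * X l k * (DD [i] [j, k] p q + DD [j, k] [i] p q))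
      + 3 * Sum_any (\<lambda>(i, j, k, l). X i j * X k l * DD [i, k] [j, l] p q))"

definition pi3 :: "('i \<Rightarrow> 'i \<Rightarrow> ('i, 'f) mpoly) \<Rightarrow> ('i, 'f::field_char_0) cochain2" where
  "pi3 X p q = smul (1/48)
     (2 * Sum_any (\<lambda>(i, j, k, l, m, n). X i j * D [i] (X k l) * D [j, k] (X m n) *
            (DD [n] [l, m] p q - DD [l, m] [n] p q))
      + Sum_any (\<lambda>(i, j, k, l, m, n). X i j * X k l * X m n * DD [i, k, m] [j, l, n] p q)
      + Sum_any (\<lambda>(i, j, k, l, m, n). D [k] (X l m) * D [l] (X j n) * X k i *
            (DD [m, n] [i, j] p q - DD [i, j] [m, n] p q))
      + Sum_any (\<lambda>(i, j, k, l, m, n). D [k, l] (X m n) * X l j * X k i *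
            (DD [m] [n, i, j] p q - DD [n, i, j] [m] p q))
      + 2 * Sum_any (\<lambda>(i, j, k, l, m, n). D [k] (X i j) * X k l * X m n *
            (DD [j, l, m] [i, n] p q - DD [i, n] [j, l, m] p q)))"

end

(*
  Associativity of the explicit formula at order n says that E_2 = pi_1 o pi_1 - delta pi_2 and
  E_3 = [pi_1, pi_2] - delta pi_3 vanish.  Since delta E_n = 0 follows from the lower orders, E_n is a
  Hochschild 3-cocycle, and such a cocycle is zero as soon as E(f, f^n, g^m) = 0 and
  E(f, g, h^m) = E(g, f, h^m) for all affine polynomials f, g, h: polarisation and the cocycle
  identity recover E(x_i, q, r), and E(x_i p, q, r) = x_i E(p, q, r) does the rest.  On powers of affine
  polynomials all but one of the summation indices of pi_2 and pi_3 are absorbed into iterated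
  brackets of f and g, and the two identities become consequences of the Jacobi identity.

  For the classification, a 2-cocycle splits into its antisymmetric part, a biderivation, and its
  symmetric part, which is the coboundary of a linear map because the polynomial algebra is free.
  A gauge transformation id + h^2 F removes the latter at second order.
*)
theory Submission
  imports Defs "HOL-Library.Multiset" "HOL-Computational_Algebra.Polynomial"
begin

subsection \<open>Polynomials and partial derivatives\<close>

text \<open>Expanding the identities as differential operators would spread the derivatives of
  six-index sums over products in very many ways. Powers of affine polynomials avoid this: first
  derivatives of an affine f are constants, so they pass through brackets and derivatives, and f^n
  enters only through its univariate derivatives at f. Two tests are needed because the first makes
  E alternating and the second symmetric in two affine arguments. The first test involves only f and
  g, so everything is built from \<alpha> = {f, g}, and {\<alpha>, \<alpha>} = 0 lets brackets of
  \<alpha> with f and g be reordered. In the second test the terms containing the product fg in the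
  first slot are symmetric and cancel, so they never have to be evaluated. The index that is not
  absorbed runs over the variables of the X_ij, which need not occur in f or g; hence the two index
  sets T and S below. With infinitely many generators this bookkeeping also makes the sums finite.
  At third order the symmetric correction must stay: its coboundary is [pi_1, phi_2], which need not
  vanish, so no gauge transformation can remove it.\<close>

abbreviation unit_exp :: "'i \<Rightarrow> ('i \<Rightarrow>\<^sub>0 nat)" where
  "unit_exp i \<equiv> Poly_Mapping.single i (Suc 0)"

text \<open>Induction on the total degree: a nonzero exponent vector has a positive entry, from
  which a unit vector can be split off.\<close>

lemma exponent_induct [case_names zero add]:
  assumes "P 0" and "\<And>i m. P m \<Longrightarrow> P (unit_exp i + m)"
  shows "P (m :: 'i \<Rightarrow>\<^sub>0 nat)"
proof (induction "\<Sum>i\<in>Poly_Mapping.keys m. Poly_Mapping.lookup m i" arbitrary: m)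
  case 0
  then have "m = 0" by (simp add: in_keys_iff poly_mapping_eqI)
  with assms(1) show ?case by simp
next
  case (Suc n)
  then obtain i where i: "i \<in> Poly_Mapping.keys m"
    by (metis Zero_not_Suc all_not_in_conv sum.empty)
  define m' where "m' = m - unit_exp i"
  have m: "m = unit_exp i + m'"
    using i by (intro poly_mapping_eqI)
      (auto simp: m'_def lookup_add lookup_minus lookup_single in_keys_iff when_def)
  let ?K = "Poly_Mapping.keys m"
  have "Poly_Mapping.keys m' \<subseteq> ?K"
    by (auto simp: m in_keys_iff lookup_add)
  then have "(\<Sum>j\<in>Poly_Mapping.keys m'. Poly_Mapping.lookup m' j) = (\<Sum>j\<in>?K. Poly_Mapping.lookup m' j)"
    by (intro sum.mono_neutral_left) (auto simp: in_keys_iff)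
  moreover have "(\<Sum>j\<in>?K. Poly_Mapping.lookup m j) = 1 + (\<Sum>j\<in>?K. Poly_Mapping.lookup m' j)"
    using i by (subst m) (simp add: lookup_add sum.distrib lookup_single when_def)
  ultimately have "n = (\<Sum>j\<in>Poly_Mapping.keys m'. Poly_Mapping.lookup m' j)"
    using Suc.hyps(2) by simp
  then show ?case using Suc.hyps(1) assms(2) m by metis
qed

lemma smul_add: "smul c (p + q) = smul c p + smul c q"
  by (simp add: smul_def algebra_simps)

lemma smul_diff: "smul c (p - q) = smul c p - smul c q"
  by (simp add: smul_def algebra_simps)

lemma smul_smul: "smul c (smul d p) = smul (c * d) p"
  by (simp add: smul_def mult.assoc[symmetric] mult_single)

lemma smul_1 [simp]: "smul 1 p = p"
  by (simp add: smul_def)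

lemma smul_0_left [simp]: "smul 0 p = 0"
  by (simp add: smul_def)

lemma smul_0_right [simp]: "smul c 0 = 0"
  by (simp add: smul_def)

lemma smul_uminus: "smul c (- p) = - smul c p"
  by (simp add: smul_def)

lemma smul_add_left: "smul (c + d) p = smul c p + smul d p"
  by (simp add: smul_def single_add distrib_right)

lemma smul_mult_left: "smul c p * q = smul c (p * q)"
  by (simp add: smul_def mult.assoc)

lemma smul_mult_right: "p * smul c q = smul c (p * q)"
  by (simp add: smul_def mult.left_commute)

lemma smul_sum: "smul c (sum f A) = (\<Sum>x\<in>A. smul c (f x))"
  by (simp add: smul_def sum_distrib_left)

lemma lookup_smul: "Poly_Mapping.lookup (smul c p) m = c * Poly_Mapping.lookup p m"
proof -
  have "smul c p = Poly_Mapping.map ((*) c) p"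
    by (simp add: smul_def mult_map_scale_conv_mult)
  then show ?thesis by (simp add: Poly_Mapping.map.rep_eq when_def)
qed

lemma numeral_smul: "numeral k * smul c p = smul (numeral k * c) p"
proof -
  have "numeral k * smul c p = Poly_Mapping.single 0 (numeral k) * smul c p" by simp
  also have "\<dots> = smul (numeral k * c) p"
    unfolding smul_def mult.assoc[symmetric] mult_single by simp
  finally show ?thesis .
qed

lemma of_nat_smul: "of_nat k * p = smul (of_nat k) p"
  by (simp add: smul_def)

lemma module_smul: "module smul"
  by standard (simp_all add: smul_add smul_add_left smul_smul)

abbreviation lin :: "(('i, 'f::field_char_0) mpoly \<Rightarrow> ('i, 'f) mpoly) \<Rightarrow> bool" where
  "lin \<equiv> module_hom smul smul"

lemma linI:
  assumes "\<And>p q. L (p + q) = L p + L q" and "\<And>c p. L (smul c p) = smul c (L p)"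
  shows "lin L"
  using assms module_smul by (auto simp: module_hom_def module_hom_axioms_def)

lemma lin_add: "lin L \<Longrightarrow> L (p + q) = L p + L q"
  by (rule module_hom.add)

lemma lin_smul: "lin L \<Longrightarrow> L (smul c p) = smul c (L p)"
  by (rule module_hom.scale)

lemma lin_0: "lin L \<Longrightarrow> L 0 = 0"
  by (rule module_hom.zero)

lemma lin_uminus: "lin L \<Longrightarrow> L (- p) = - L p"
  by (rule module_hom.neg)

lemma lin_diff: "lin L \<Longrightarrow> L (p - q) = L p - L q"
  by (rule module_hom.diff)

lemma lin_sum: "lin L \<Longrightarrow> L (sum f A) = (\<Sum>x\<in>A. L (f x))"
  by (rule module_hom.sum)

lemma poly_eq_sum_monomials:
  "p = (\<Sum>m\<in>Poly_Mapping.keys p. smul (Poly_Mapping.lookup p m) (Poly_Mapping.single m 1))"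
  by (intro poly_mapping_eqI)
    (simp add: lookup_sum lookup_smul lookup_single when_def in_keys_iff if_distrib cong: if_cong)

lemma gen_times_monomial: "gen i * Poly_Mapping.single m c = Poly_Mapping.single (unit_exp i + m) c"
  by (simp add: gen_def mult_single)

lemma mpoly_induct [case_names one gen add smul]:
  assumes "P 1" and "\<And>i p. P p \<Longrightarrow> P (gen i * p)"
    and "\<And>p q. P p \<Longrightarrow> P q \<Longrightarrow> P (p + q)" and "\<And>c p. P p \<Longrightarrow> P (smul c p)"
  shows "P (p :: ('i, 'f::field_char_0) mpoly)"
proof -
  have mono: "P (Poly_Mapping.single m 1)" for m
    by (induction m rule: exponent_induct)
      (use assms(1,2) in \<open>auto simp flip: gen_times_monomial\<close>)
  have P0: "P 0" using assms(4)[OF assms(1), of 0] by simp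
  have "P (\<Sum>m\<in>K. smul (c m) (Poly_Mapping.single m 1))" if "finite K" for K c
    using that
  proof (induction K)
    case empty then show ?case by (simp add: P0)
  next
    case (insert x K) then show ?case using assms(3)[OF assms(4)[OF mono]] by simp
  qed
  then show ?thesis
    using poly_eq_sum_monomials[of p] finite_keys[of p] by metis
qed

lemma lin_eqI:
  assumes "lin L" "lin M" and "\<And>m. L (Poly_Mapping.single m 1) = M (Poly_Mapping.single m 1)"
  shows "L p = M p"
  by (subst (1 2) poly_eq_sum_monomials) (simp add: lin_sum lin_smul assms)

text \<open>On coefficients the truncated subtraction of exponents disappears; linearity and
  commutation of partial derivatives can then be read off coefficientwise.\<close>

lemma lookup_pderiv_var:
  "Poly_Mapping.lookup (pderiv_var i p) m =
     of_nat (Poly_Mapping.lookup m i + 1) * Poly_Mapping.lookup p (unit_exp i + m)"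
proof -
  have "Poly_Mapping.lookup (Poly_Mapping.single (n - unit_exp i)
          (of_nat (Poly_Mapping.lookup n i) * Poly_Mapping.lookup p n)) m =
        (of_nat (Poly_Mapping.lookup m i + 1) * Poly_Mapping.lookup p (unit_exp i + m) when n = unit_exp i + m)" for n
  proof (cases "Poly_Mapping.lookup n i = 0 \<or> n = unit_exp i + m")
    case True
    then show ?thesis by (auto simp: lookup_single lookup_add when_def)
  next
    case False
    then have "n = unit_exp i + (n - unit_exp i)"
      by (intro poly_mapping_eqI) (auto simp: lookup_add lookup_minus lookup_single when_def)
    with False have "n - unit_exp i \<noteq> m" by auto
    with False show ?thesis by (simp add: lookup_single when_def)
  qed
  then show ?thesis
    by (simp add: pderiv_var_def lookup_sum when_def in_keys_iff)
qed

lemma lin_pderiv_var: "lin (pderiv_var i)"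
  by (rule linI; rule poly_mapping_eqI)
    (simp_all add: lookup_pderiv_var lookup_add lookup_smul algebra_simps)

lemmas pderiv_var_add = lin_add[OF lin_pderiv_var]
  and pderiv_var_smul = lin_smul[OF lin_pderiv_var]
  and pderiv_var_0 [simp] = lin_0[OF lin_pderiv_var]
  and pderiv_var_uminus = lin_uminus[OF lin_pderiv_var]
  and pderiv_var_sum = lin_sum[OF lin_pderiv_var]

lemma pderiv_var_commute: "pderiv_var i (pderiv_var j p) = pderiv_var j (pderiv_var i p)"
  by (rule poly_mapping_eqI)
    (auto simp: lookup_pderiv_var lookup_add lookup_single when_def algebra_simps)

lemma pderiv_var_1 [simp]: "pderiv_var i 1 = 0"
  by (rule poly_mapping_eqI)
    (auto simp: lookup_pderiv_var lookup_one when_def lookup_add dest!: arg_cong[where f = "\<lambda>m. Poly_Mapping.lookup m i"])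

lemma pderiv_var_gen_mult:
  "pderiv_var i (gen j * p) = gen j * pderiv_var i p + (if i = j then p else 0)"
proof (rule lin_eqI[where p = p])
  fix m :: "'a \<Rightarrow>\<^sub>0 nat"
  have *: "unit_exp j + m = unit_exp i + n \<longleftrightarrow> (if i = j then m = n else \<exists>k. m = unit_exp i + k \<and> n = unit_exp j + k)" for n
  proof (cases "i = j")
    case False
    {
      assume eq: "unit_exp j + m = unit_exp i + n"
      define k where "k = m - unit_exp i"
      have e: "Poly_Mapping.lookup (unit_exp j + m) x = Poly_Mapping.lookup (unit_exp i + n) x" for x
        using eq by simp
      have m: "m = unit_exp i + k" using e[of i] False
        by (intro poly_mapping_eqI)
          (auto simp: k_def lookup_add lookup_minus lookup_single when_def)
      with eq have "n = unit_exp j + k" by (simp add: add.left_commute)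
      with m have "\<exists>k. m = unit_exp i + k \<and> n = unit_exp j + k" by blast
    }
    with False show ?thesis by (auto simp: add.left_commute)
  qed simp
  have P: "pderiv_var i (Poly_Mapping.single m (1::'b)) =
      Poly_Mapping.single (m - unit_exp i) (of_nat (Poly_Mapping.lookup m i))" for m
    by (simp add: pderiv_var_def)
  \<comment> \<open>Truncated subtraction commutes with adding a unit vector once the exponent of
    \<open>i\<close> is positive; the other case is treated separately below.\<close>
  have Q: "(unit_exp j + m) - unit_exp i = unit_exp j + (m - unit_exp i)" if "Poly_Mapping.lookup m i \<noteq> 0"
    using that by (intro poly_mapping_eqI)
      (auto simp: lookup_add lookup_minus lookup_single when_def)
  show "pderiv_var i (gen j * Poly_Mapping.single m (1::'b)) =
     gen j * pderiv_var i (Poly_Mapping.single m 1) + (if i = j then Poly_Mapping.single m 1 else 0)"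
  proof (cases "Poly_Mapping.lookup m i = 0")
    case False
    have "unit_exp j + (m - unit_exp i) = m" if "i = j" using Q[OF False] that by simp
    with False show ?thesis
      by (auto simp: gen_times_monomial P Q lookup_add lookup_single when_def single_add)
  qed (auto simp: gen_times_monomial P lookup_add lookup_single when_def)
qed (auto intro!: linI simp: pderiv_var_add pderiv_var_smul smul_add smul_mult_right algebra_simps)

lemma pderiv_var_gen: "pderiv_var i (gen j) = (if i = j then 1 else 0)"
  using pderiv_var_gen_mult[of i j 1] by simp

lemma pderiv_var_mult: "pderiv_var i (p * q) = pderiv_var i p * q + p * pderiv_var i q"
  by (induction p rule: mpoly_induct)
    (auto simp: pderiv_var_gen_mult mult.assoc pderiv_var_add pderiv_var_smul smul_mult_left smul_add
      distrib_left distrib_right add_ac)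

text \<open>In characteristic 0 these are the generators that occur in \<open>p\<close>. Stated
  through derivatives, it gives directly the index range of every sum whose terms contain a
  derivative of \<open>p\<close>.\<close>

definition vars :: "('i, 'f::field_char_0) mpoly \<Rightarrow> 'i set" where
  "vars p = {i. pderiv_var i p \<noteq> 0}"

lemma not_in_vars: "i \<notin> vars p \<Longrightarrow> pderiv_var i p = 0"
  by (simp add: vars_def)

lemma finite_vars [simp]: "finite (vars p)"
proof (induction p rule: mpoly_induct)
  case (gen i p)
  have "vars (gen i * p) \<subseteq> insert i (vars p)" by (auto simp: vars_def pderiv_var_gen_mult)
  then show ?case using gen finite_subset by blast
next
  case (add p q)
  have "vars (p + q) \<subseteq> vars p \<union> vars q" by (auto simp: vars_def pderiv_var_add)
  then show ?case using add finite_subset by blast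
next
  case (smul c p)
  have "vars (smul c p) \<subseteq> vars p" by (auto simp: vars_def pderiv_var_smul)
  then show ?case using smul finite_subset by blast
qed (simp add: vars_def)

lemma vars_pderiv_var: "vars (pderiv_var i p) \<subseteq> vars p"
  by (auto simp: vars_def pderiv_var_commute[of _ i])

subsection \<open>Derivations\<close>

definition derivation :: "(('i, 'f::field_char_0) mpoly \<Rightarrow> ('i, 'f) mpoly) \<Rightarrow> bool" where
  "derivation d \<longleftrightarrow> lin d \<and> (\<forall>p q. d (p * q) = d p * q + p * d q)"

lemma derivation_one: "derivation d \<Longrightarrow> d 1 = 0"
  using add_cancel_right_right by (metis derivation_def mult.right_neutral mult_1)

lemma derivation_eq_sum_vars:
  assumes "derivation d"
  shows "d p = (\<Sum>i\<in>vars p. pderiv_var i p * d (gen i))"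
proof -
  \<comment> \<open>The claim is strengthened to all finite index sets above some \<open>S\<close>,
    so that in the inductive steps the sums for several polynomials run over a common set.\<close>
  have "\<exists>S. finite S \<and> (\<forall>T. finite T \<longrightarrow> S \<subseteq> T \<longrightarrow> d p = (\<Sum>i\<in>T. pderiv_var i p * d (gen i)))"
  proof (induction p rule: mpoly_induct)
    case one
    then show ?case using derivation_one[OF assms] by (auto intro!: exI[of _ "{}"])
  next
    case (gen i p)
    then obtain S where S: "finite S" "\<And>T. finite T \<Longrightarrow> S \<subseteq> T \<Longrightarrow> d p = (\<Sum>i\<in>T. pderiv_var i p * d (gen i))"
      by blast
    have "d (gen i * p) = (\<Sum>j\<in>T. pderiv_var j (gen i * p) * d (gen j))"
      if "finite T" "insert i S \<subseteq> T" for T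
    proof -
      have "(\<Sum>j\<in>T. pderiv_var j (gen i * p) * d (gen j)) =
          gen i * (\<Sum>j\<in>T. pderiv_var j p * d (gen j)) + (\<Sum>j\<in>T. (if j = i then p else 0) * d (gen j))"
        by (simp add: pderiv_var_gen_mult distrib_right sum.distrib sum_distrib_left mult.assoc)
      also have "(\<Sum>j\<in>T. (if j = i then p else 0) * d (gen j)) = p * d (gen i)"
        using that by (simp add: if_distribR if_distrib cong: if_cong)
      also have "(\<Sum>j\<in>T. pderiv_var j p * d (gen j)) = d p"
        using S(2) that by simp
      finally show ?thesis using assms by (simp add: derivation_def algebra_simps)
    qed
    then show ?case using S(1) by (intro exI[of _ "insert i S"]) auto
  next
    case (add p q)
    then obtain S S' where "finite S" "finite S'"
      "\<And>T. finite T \<Longrightarrow> S \<subseteq> T \<Longrightarrow> d p = (\<Sum>i\<in>T. pderiv_var i p * d (gen i))"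
      "\<And>T. finite T \<Longrightarrow> S' \<subseteq> T \<Longrightarrow> d q = (\<Sum>i\<in>T. pderiv_var i q * d (gen i))"
      by blast
    then show ?case using assms
      by (intro exI[of _ "S \<union> S'"])
        (auto simp: derivation_def lin_add pderiv_var_add distrib_right sum.distrib)
  next
    case (smul c p)
    then obtain S where "finite S" "\<And>T. finite T \<Longrightarrow> S \<subseteq> T \<Longrightarrow> d p = (\<Sum>i\<in>T. pderiv_var i p * d (gen i))"
      by blast
    moreover have "d (smul c p) = smul c (d p)"
      using assms by (simp add: derivation_def lin_smul)
    moreover have "(\<Sum>i\<in>T. pderiv_var i (smul c p) * d (gen i)) = smul c (\<Sum>i\<in>T. pderiv_var i p * d (gen i))" for T
      by (simp only: pderiv_var_smul smul_mult_left smul_sum)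
    ultimately show ?case by metis
  qed
  then obtain S where S: "finite S" "\<And>T. finite T \<Longrightarrow> S \<subseteq> T \<Longrightarrow> d p = (\<Sum>i\<in>T. pderiv_var i p * d (gen i))"
    by blast
  have "d p = (\<Sum>i\<in>S \<union> vars p. pderiv_var i p * d (gen i))"
    using S(1) by (intro S(2)) auto
  also have "\<dots> = (\<Sum>i\<in>vars p. pderiv_var i p * d (gen i))"
    using S(1) by (intro sum.mono_neutral_right) (auto simp: not_in_vars)
  finally show ?thesis .
qed

lemma derivation_eq_sum:
  assumes "derivation d" "finite S" "vars p \<subseteq> S"
  shows "d p = (\<Sum>i\<in>S. pderiv_var i p * d (gen i))"
  unfolding derivation_eq_sum_vars[OF assms(1), of p]
  using assms by (intro sum.mono_neutral_left) (auto simp: not_in_vars)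

subsection \<open>Polarisation\<close>

text \<open>In characteristic 0 this is degree at most one. The form is the one in which it is used:
  first derivatives have no derivatives.\<close>

definition affine :: "('i, 'f::field_char_0) mpoly \<Rightarrow> bool" where
  "affine f \<longleftrightarrow> (\<forall>i j. pderiv_var i (pderiv_var j f) = 0)"

lemma affine_gen: "affine (gen i)"
  by (simp add: affine_def pderiv_var_gen)

lemma affine_one: "affine 1"
  by (simp add: affine_def)

lemma affine_add: "affine f \<Longrightarrow> affine g \<Longrightarrow> affine (f + g)"
  by (simp add: affine_def pderiv_var_add)

lemma affine_smul: "affine f \<Longrightarrow> affine (smul c f)"
  by (simp add: affine_def pderiv_var_smul)

lemma of_nat_Suc_mult_eq_0:
  assumes "of_nat (Suc n) * (p :: ('i, 'f::field_char_0) mpoly) = 0"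
  shows "p = 0"
proof -
  have "p = smul (inverse (of_nat (Suc n))) (of_nat (Suc n) * p)"
    by (simp only: of_nat_smul smul_smul) (simp del: of_nat_Suc)
  with assms show ?thesis by simp
qed

lemma smul_power: "(smul t z) ^ k = smul (t ^ k) (z ^ k)"
  by (induction k) (simp_all add: smul_mult_left smul_mult_right smul_smul mult_ac)

text \<open>The hypothesis is a polynomial identity in the scalar \<open>t\<close>, valid on an
  infinite field, so each coefficient vanishes. The conclusion is the coefficient of
  \<open>t\<close>: \<open>L\<close> contributes the binomial term with one \<open>z\<close>, and
  \<open>M\<close>, which carries an extra \<open>t\<close>, the term with none.\<close>

lemma first_order_coefficient:
  fixes f z :: "('i, 'f::field_char_0) mpoly"
  assumes L: "lin L" and M: "lin M"
    and zero: "\<And>t. L ((f + smul t z) ^ Suc n) + smul t (M ((f + smul t z) ^ Suc n)) = 0"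
  shows "of_nat (Suc n) * L (z * f ^ n) + M (f ^ Suc n) = 0"
proof (rule poly_mapping_eqI)
  fix m
  define b where "b k = of_nat (Suc n choose k) * z ^ k * f ^ (Suc n - k)" for k
  have binom: "(f + smul t z) ^ Suc n = (\<Sum>k\<le>Suc n. smul (t ^ k) (b k))" for t
    by (simp only: add.commute[of f] binomial_ring smul_power smul_mult_left smul_mult_right b_def mult.assoc)
  \<comment> \<open>A univariate polynomial in \<open>t\<close>, obtained by fixing one coefficient
    position \<open>m\<close> of the multivariate values.\<close>
  define P where "P = (\<Sum>k\<le>Suc n. Polynomial.monom (Poly_Mapping.lookup (L (b k)) m) k) +
    (\<Sum>k\<le>Suc n. Polynomial.monom (Poly_Mapping.lookup (M (b k)) m) (Suc k))"
  have "poly P t = 0" for t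
  proof -
    have "poly P t = Poly_Mapping.lookup (L ((f + smul t z) ^ Suc n) + smul t (M ((f + smul t z) ^ Suc n))) m"
      unfolding binom lin_sum[OF L] lin_sum[OF M] lin_smul[OF L] lin_smul[OF M]
      by (simp only: P_def poly_sum poly_add poly_monom lookup_add lookup_smul lookup_sum smul_sum smul_smul
          power_Suc) (simp add: mult_ac)
    then show ?thesis by (simp only: zero lookup_zero)
  qed
  then have "P = 0" using poly_all_0_iff_0 by blast
  then have "Polynomial.coeff P 1 = 0" by simp
  then have "Poly_Mapping.lookup (L (b 1)) m + Poly_Mapping.lookup (M (b 0)) m = 0"
    by (auto simp: P_def coeff_sum split: if_splits)
  moreover have "L (b 1) = of_nat (Suc n) * L (z * f ^ n)"
    by (simp only: b_def of_nat_smul smul_mult_left lin_smul[OF L] choose_one power_one_right diff_Suc_1)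
  moreover have "b 0 = f ^ Suc n" by (simp add: b_def)
  ultimately show "Poly_Mapping.lookup (of_nat (Suc n) * L (z * f ^ n) + M (f ^ Suc n)) m =
      Poly_Mapping.lookup 0 m"
    by (simp only: lookup_add lookup_zero)
qed

lemma lin_zero: "lin (\<lambda>p. 0)"
  by (rule linI) simp_all

lemma lin_mult_left: "lin L \<Longrightarrow> lin (\<lambda>p. L (q * p))"
  by (rule linI) (simp_all add: distrib_left lin_add smul_mult_right lin_smul)

text \<open>Powers of affine polynomials span the algebra: replacing \<open>f\<close> by
  \<open>f + smul t (gen i)\<close> and taking the coefficient of \<open>t\<close> trades one factor
  \<open>f\<close> for a generator.\<close>

lemma polarization:
  assumes L: "lin L" and zero: "\<And>f n. affine f \<Longrightarrow> L (f ^ n) = 0"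
  shows "L p = 0"
proof -
  \<comment> \<open>A power is kept next to the monomial so that further generators can be split off
    from it; \<open>f = 1\<close> and \<open>n = 0\<close> finally leave the monomial alone.\<close>
  have *: "affine f \<Longrightarrow> L (Poly_Mapping.single m 1 * f ^ n) = 0" for m f n
  proof (induction m arbitrary: f n rule: exponent_induct)
    case zero
    then show ?case by (simp add: assms(2))
  next
    case (add i m)
    let ?L = "\<lambda>p. L (Poly_Mapping.single m 1 * p)"
    have "of_nat (Suc n) * ?L (gen i * f ^ n) + 0 = 0"
      by (rule first_order_coefficient[OF lin_mult_left[OF L] lin_zero])
        (simp add: add.IH add.prems affine_add affine_smul affine_gen del: power_Suc)
    then have "?L (gen i * f ^ n) = 0"
      using of_nat_Suc_mult_eq_0 by (metis add.right_neutral)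
    moreover have "Poly_Mapping.single m 1 * (gen i * f ^ n) = Poly_Mapping.single (unit_exp i + m) 1 * f ^ n"
      by (simp flip: gen_times_monomial add: mult_ac)
    ultimately show ?case by simp
  qed
  show ?thesis
    by (rule lin_eqI[OF L lin_zero]) (use *[OF affine_one, of _ 0] in simp)
qed


subsection \<open>Vanishing of Hochschild 3-cocycles\<close>

definition cocycle3 :: "(('i, 'f) mpoly \<Rightarrow> ('i, 'f) mpoly \<Rightarrow> ('i, 'f) mpoly \<Rightarrow> ('i, 'f::field_char_0) mpoly) \<Rightarrow> bool"
  where "cocycle3 E \<longleftrightarrow>
     (\<forall>q r. lin (\<lambda>p. E p q r)) \<and> (\<forall>p r. lin (\<lambda>q. E p q r)) \<and> (\<forall>p q. lin (\<lambda>r. E p q r)) \<and>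
     (\<forall>p q r s. p * E q r s - E (p * q) r s + E p (q * r) s - E p q (r * s) + E p q r * s = 0)"

text \<open>Cohomology would determine \<open>E\<close> only up to coboundaries. The test values pin
  down \<open>E\<close> itself, starting from affine arguments and propagating through the cocycle
  identity.\<close>

lemma cocycle3_eq_0:
  assumes E: "cocycle3 E"
    and diag: "\<And>f g n m. affine f \<Longrightarrow> affine g \<Longrightarrow> E f (f ^ n) (g ^ m) = 0"
    and sym: "\<And>f g h m. affine f \<Longrightarrow> affine g \<Longrightarrow> affine h \<Longrightarrow> E f g (h ^ m) = E g f (h ^ m)"
  shows "E p q r = 0"
proof -
  have l1: "lin (\<lambda>p. E p q r)" and l2: "lin (\<lambda>q. E p q r)" and l3: "lin (\<lambda>r. E p q r)"
    and cocycle: "p * E q r s - E (p * q) r s + E p (q * r) s - E p q (r * s) + E p q r * s = 0"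
    for p q r s
    using E unfolding cocycle3_def by blast+
  have diag': "E f (f ^ n) r = 0" if "affine f" for f n r
    by (rule polarization[OF l3]) (rule diag[OF that])
  have sym': "E f g r = E g f r" if "affine f" "affine g" for f g r
  proof -
    have "lin (\<lambda>r. E f g r - E g f r)"
      by (rule linI) (simp_all add: lin_add[OF l3] lin_smul[OF l3] smul_diff)
    then have "E f g r - E g f r = 0"
      by (rule polarization) (simp add: sym[OF that])
    then show ?thesis by simp
  qed
  \<comment> \<open>Applied to \<open>f + g\<close>, the diagonal condition makes \<open>E\<close>
    alternating in two affine arguments; together with symmetry this gives 2 E = 0.\<close>
  have two: "E f g r = 0" if "affine f" "affine g" for f g r
  proof -
    have "E h h r = 0" if "affine h" for h
      using diag'[OF that, of 1] by simp
    with that have "E (f + g) (f + g) r = 0" "E f f r = 0" "E g g r = 0"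
      by (simp_all add: affine_add)
    then have "of_nat (Suc 1) * E f g r = 0"
      using sym'[OF that] by (simp add: lin_add[OF l1] lin_add[OF l2])
    then show ?thesis by (rule of_nat_Suc_mult_eq_0)
  qed
  have one: "E 1 q r = 0" for q r
    using cocycle[of 1 1 q r] diag'[OF affine_one, of 0] by simp
  \<comment> \<open>The cocycle identity at \<open>(z, f, f ^ n, r)\<close> and at
    \<open>(f, z, f ^ n, r)\<close> shows that \<open>E (z * f) (f ^ n) r\<close> equals both
    \<open>E z (f ^ Suc n) r\<close> and \<open>E f (z * f ^ n) r\<close>. The t-coefficient of the
    diagonal condition at \<open>f + smul t z\<close> is a second relation between these two;
    combined they give n + 2 times the value, which must vanish.\<close>
  have powers: "E z (f ^ n) r = 0" if "affine z" "affine f" for z f n r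
  proof (induction n)
    case 0
    show ?case using diag'[OF that(1), of 0] by simp
  next
    case (Suc n)
    have "E (z * f) (f ^ n) r = E z (f ^ Suc n) r"
      using cocycle[of z f "f ^ n" r] diag'[OF that(2)] two[OF that] by simp
    moreover have "E (f * z) (f ^ n) r = E f (z * f ^ n) r"
      using cocycle[of f z "f ^ n" r] Suc two[OF that(2,1)] by simp
    ultimately have eq: "E z (f ^ Suc n) r = E f (z * f ^ n) r"
      by (simp add: mult.commute)
    have "of_nat (Suc n) * E f (z * f ^ n) r + E z (f ^ Suc n) r = 0"
    proof (rule first_order_coefficient[OF l2 l2])
      fix t
      have "E (f + smul t z) ((f + smul t z) ^ Suc n) r = 0"
        by (intro diag' affine_add affine_smul that)
      then show "E f ((f + smul t z) ^ Suc n) r + smul t (E z ((f + smul t z) ^ Suc n) r) = 0"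
        by (simp only: lin_add[OF l1] lin_smul[OF l1])
    qed
    with eq have "of_nat (Suc (Suc n)) * E z (f ^ Suc n) r = 0"
      by (simp add: algebra_simps)
    then show ?case by (rule of_nat_Suc_mult_eq_0)
  qed
  have gen: "E (gen i) q r = 0" for i q r
    by (rule polarization[OF l2]) (rule powers[OF affine_gen])
  show ?thesis
  proof (induction p arbitrary: q r rule: mpoly_induct)
    case (gen i p)
    then show ?case using cocycle[of "gen i" p q r] \<open>\<And>i q r. E (gen i) q r = 0\<close> by simp
  qed (simp_all add: one lin_add[OF l1] lin_smul[OF l1])
qed

subsection \<open>Hochschild 2-cocycles\<close>

lemma cochain_lin1: "is_cochain2 c \<Longrightarrow> lin (\<lambda>p. c p q)"
  and cochain_lin2: "is_cochain2 c \<Longrightarrow> lin (c p)"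
  by (auto simp: is_cochain2_def)

lemmas cochain_add1 = lin_add[OF cochain_lin1]
  and cochain_add2 = lin_add[OF cochain_lin2]
  and cochain_smul1 = lin_smul[OF cochain_lin1]
  and cochain_smul2 = lin_smul[OF cochain_lin2]
  and cochain_diff1 = lin_diff[OF cochain_lin1]
  and cochain_diff2 = lin_diff[OF cochain_lin2]
  and cochain_uminus1 = lin_uminus[OF cochain_lin1]
  and cochain_uminus2 = lin_uminus[OF cochain_lin2]
  and cochain_zero1 = lin_0[OF cochain_lin1]
  and cochain_zero2 = lin_0[OF cochain_lin2]

lemmas cochain_simps = cochain_add1 cochain_add2 cochain_smul1 cochain_smul2 cochain_diff1 cochain_diff2
  cochain_uminus1 cochain_uminus2 cochain_zero1 cochain_zero2

lemma cochainI:
  assumes "\<And>p p' q. c (p + p') q = c p q + c p' q" "\<And>a p q. c (smul a p) q = smul a (c p q)"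
    and "\<And>p q q'. c p (q + q') = c p q + c p q'" "\<And>a p q. c p (smul a q) = smul a (c p q)"
  shows "is_cochain2 c"
  using assms by (auto simp: is_cochain2_def intro!: linI)

lemma cochain_sum: "is_cochain2 c \<Longrightarrow> is_cochain2 d \<Longrightarrow> is_cochain2 (\<lambda>p q. c p q + d p q)"
  by (rule cochainI) (simp_all add: cochain_simps smul_add)

lemma hochschild_sum: "hochschild (\<lambda>p q. c p q + d p q) p q r = hochschild c p q r + hochschild d p q r"
  by (simp add: hochschild_def algebra_simps)

lemma hochschild_difference: "hochschild (\<lambda>p q. c p q - d p q) p q r = hochschild c p q r - hochschild d p q r"
  by (simp add: hochschild_def algebra_simps)

lemma biderivation_hochschild:
  assumes "biderivation c"
  shows "hochschild c p q r = 0"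
  using assms by (simp add: biderivation_def hochschild_def algebra_simps)

text \<open>The cocycle identities at (p, q, r), (p, r, q) and (r, p, q), combined with signs +, -,
  +, leave twice the Leibniz rule in the first argument. Antisymmetry transfers it to the
  second.\<close>

lemma antisymmetric_cocycle_biderivation:
  assumes c: "is_cochain2 c" and anti: "antisymmetric c" and cocycle: "\<And>p q r. hochschild c p q r = 0"
  shows "biderivation c"
proof -
  have anti': "c p q = - c q p" for p q
    using anti unfolding antisymmetric_def by blast
  have left: "c (p * q) r = p * c q r + c p r * q" for p q r
  proof -
    have "p * c q r - c (p * q) r + c p (q * r) - c p q * r = 0"
      "r * c p q - c (p * r) q + c r (p * q) - c r p * q = 0"
      "p * c r q - c (p * r) q + c p (q * r) - c p r * q = 0"
      using cocycle[of p q r] cocycle[of r p q] cocycle[of p r q]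
      by (simp_all add: hochschild_def mult.commute)
    moreover have "2 * (x - (p * a + b * q)) = 0"
      if "p * a - x + y - d * r = 0" "r * d - z + (- x) - (- b) * q = 0" "p * (- a) - z + y - b * q = 0"
      for a b d x y z
    proof -
      have "2 * (x - (p * a + b * q)) = - ((p * a - x + y - d * r) -
          (p * (- a) - z + y - b * q) + (r * d - z + (- x) - (- b) * q))"
        by (simp add: algebra_simps)
      then show ?thesis by (simp only: that) simp
    qed
    ultimately have "2 * (c (p * q) r - (p * c q r + c p r * q)) = 0"
      using anti'[of r "p * q"] anti'[of r p] anti'[of r q] by metis
    then have "of_nat (Suc 1) * (c (p * q) r - (p * c q r + c p r * q)) = 0"
      by simp
    then have "c (p * q) r - (p * c q r + c p r * q) = 0" by (rule of_nat_Suc_mult_eq_0)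
    then show ?thesis by simp
  qed
  moreover have "c p (q * r) = q * c p r + c p q * r" for p q r
    unfolding anti'[of p] left by (simp add: algebra_simps)
  ultimately show ?thesis using c by (simp add: biderivation_def)
qed

section \<open>Symmetric Hochschild cocycles are coboundaries\<close>

definition exponent_mset :: "('i \<Rightarrow>\<^sub>0 nat) \<Rightarrow> 'i multiset" where
  "exponent_mset m = Abs_multiset (Poly_Mapping.lookup m)"

lemma count_exponent_mset: "count (exponent_mset m) = Poly_Mapping.lookup m"
  unfolding exponent_mset_def using finite_lookup[of m] by (intro Abs_multiset_inverse) simp

lemma exponent_mset_add: "exponent_mset (unit_exp i + m) = add_mset i (exponent_mset m)"
  by (rule multiset_eqI) (simp add: count_exponent_mset lookup_add lookup_single when_def)

lemma exponent_mset_0: "exponent_mset 0 = {#}"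
  by (rule multiset_eqI) (simp add: count_exponent_mset)

text \<open>A symmetric cocycle describes a commutative square-zero extension of the polynomial algebra,
  which splits because the algebra is free: the splitting is determined on monomials by the
  images of the generators, and symmetry makes it independent of the order of the factors.\<close>

lemma symmetric_cocycle_coboundary:
  fixes c :: "('i, 'f::field_char_0) cochain2"
  assumes c: "is_cochain2 c" and symm: "symmetric c" and cocycle: "\<And>p q r. hochschild c p q r = 0"
  obtains F where "lin F" "\<And>p q. c p q = p * F q - F (p * q) + F p * q"
proof -
  have sym: "c p q = c q p" for p q
    using symm unfolding symmetric_def by blast
  have cocycle: "p * c q r - c (p * q) r + c p (q * r) - c p q * r = 0" for p q r
    using cocycle unfolding hochschild_def by blast
  \<comment> \<open>A pair consists of a monomial p and the value F(p). The step is the coboundary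
    equation for c(x_i, p) solved for F(x_i p), with F(x_i) chosen to be 0.\<close>
  define step where "step i = (\<lambda>(p, a). (gen i * p, gen i * a - c (gen i) p))" for i
  have "comp_fun_commute step"
  proof
    show "step j \<circ> step i = step i \<circ> step j" for i j
    proof (rule ext)
      fix x :: "('i, 'f) mpoly \<times> ('i, 'f) mpoly"
      obtain p a where x: "x = (p, a)" by fastforce
      \<comment> \<open>Exchanging the two generators in the cocycle identity changes only these
        terms, by symmetry of \<open>c\<close>; this is the order independence of the
        construction.\<close>
      have "gen i * c (gen j) p + c (gen i) (gen j * p) = gen j * c (gen i) p + c (gen j) (gen i * p)"
        using cocycle[of "gen i" "gen j" p] cocycle[of "gen j" "gen i" p] sym[of "gen i" "gen j"]
        by (simp add: algebra_simps)
      then show "(step j \<circ> step i) x = (step i \<circ> step j) x"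
        by (simp add: step_def x algebra_simps)
    qed
  qed
  then interpret comp_fun_commute step .
  \<comment> \<open>A multiset fold visits the generators without requiring an order on them. The
    initial value \<open>c 1 1\<close> is forced by the coboundary equation at (1, 1).\<close>
  define S where "S m = fold_mset step (1, c 1 1) (exponent_mset m)" for m
  define G where "G m = snd (S m)" for m
  have S_0: "S 0 = (1, c 1 1)" by (simp add: S_def exponent_mset_0)
  have S_add: "S (unit_exp i + m) = step i (S m)" for i m by (simp add: S_def exponent_mset_add)
  have "fst (S m) = Poly_Mapping.single m 1" for m
    by (induction m rule: exponent_induct)
      (simp_all add: S_0 S_add step_def case_prod_unfold gen_times_monomial)
  then have G_add: "G (unit_exp i + m) = gen i * G m - c (gen i) (Poly_Mapping.single m 1)" for i m
    by (simp add: G_def S_add step_def case_prod_unfold)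
  define F where "F p = (\<Sum>m\<in>Poly_Mapping.keys p. smul (Poly_Mapping.lookup p m) (G m))" for p
  have F_superset: "F p = (\<Sum>m\<in>K. smul (Poly_Mapping.lookup p m) (G m))"
    if "finite K" "Poly_Mapping.keys p \<subseteq> K" for p K
    unfolding F_def using that by (intro sum.mono_neutral_left) (auto simp: in_keys_iff)
  have F: "lin F"
  proof (rule linI)
    show "F (p + q) = F p + F q" for p q
    proof -
      let ?K = "Poly_Mapping.keys p \<union> Poly_Mapping.keys q"
      have "F (p + q) = (\<Sum>m\<in>?K. smul (Poly_Mapping.lookup (p + q) m) (G m))"
        by (rule F_superset) (use keys_add[of p q] in auto)
      also have "\<dots> = F p + F q"
        by (simp add: F_superset[of ?K] lookup_add smul_add_left sum.distrib)
      finally show ?thesis .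
    qed
    show "F (smul a p) = smul a (F p)" for a p
    proof -
      have "F (smul a p) = (\<Sum>m\<in>Poly_Mapping.keys p. smul (Poly_Mapping.lookup (smul a p) m) (G m))"
        by (rule F_superset) (auto simp: in_keys_iff lookup_smul)
      then show ?thesis by (simp add: F_def lookup_smul smul_sum smul_smul)
    qed
  qed
  have F_single: "F (Poly_Mapping.single m 1) = G m" for m
    by (simp add: F_def)
  have F_gen: "F (gen i * p) = gen i * F p - c (gen i) p" for i p
    by (rule lin_eqI)
      (auto intro!: linI simp: lin_add[OF F] lin_smul[OF F] cochain_simps[OF c] distrib_left
        smul_mult_right smul_diff F_single G_add gen_times_monomial)
  have F_one: "F 1 = c 1 1"
    using F_single[of 0] by (simp add: G_def S_0)
  have "c p q = p * F q - F (p * q) + F p * q" for p q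
  proof (induction p rule: mpoly_induct)
    case one
    show ?case using cocycle[of 1 1 q] by (simp add: F_one)
  next
    case (gen i p)
    have "c (gen i * p) q = gen i * c p q + c (gen i) (p * q) - c (gen i) p * q"
      using cocycle[of "gen i" p q] by (simp add: algebra_simps)
    then show ?case unfolding gen mult.assoc F_gen by (simp add: algebra_simps)
  next
    case (add p p')
    then show ?case by (simp add: cochain_simps[OF c] lin_add[OF F] algebra_simps)
  next
    case (smul a p)
    then show ?case
      by (simp add: cochain_simps[OF c] lin_smul[OF F] smul_mult_left smul_mult_right smul_add smul_diff)
  qed
  with F that show ?thesis by blast
qed

text \<open>Since A is commutative, exchanging the arguments of \<open>c\<close> turns its
  coboundary at (p, q, r) into minus the coboundary of \<open>c\<close> at (r, q, p). The two halves
  therefore receive the difference and the sum.\<close>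

lemma cochain_split:
  assumes c: "is_cochain2 c"
  obtains s a where "is_cochain2 s" "symmetric s" "is_cochain2 a" "antisymmetric a"
    "c = (\<lambda>p q. s p q + a p q)"
    "\<And>p q r. hochschild s p q r = smul (1/2) (hochschild c p q r - hochschild c r q p)"
    "\<And>p q r. hochschild a p q r = smul (1/2) (hochschild c p q r + hochschild c r q p)"
proof -
  define s a where "s p q = smul (1/2) (c p q + c q p)" and "a p q = smul (1/2) (c p q - c q p)" for p q
  show ?thesis
  proof (rule that)
    show "is_cochain2 s" "is_cochain2 a"
      by (auto intro!: cochainI simp: s_def a_def cochain_simps[OF c] smul_add smul_diff smul_smul)
    show "symmetric s" "antisymmetric a"
      by (auto simp: symmetric_def antisymmetric_def s_def a_def add.commute simp flip: smul_uminus)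
    show "c = (\<lambda>p q. s p q + a p q)"
      by (intro ext) (simp add: s_def a_def smul_add smul_diff numeral_smul)
    show "hochschild s p q r = smul (1/2) (hochschild c p q r - hochschild c r q p)"
      "hochschild a p q r = smul (1/2) (hochschild c p q r + hochschild c r q p)" for p q r
      by (simp_all add: hochschild_def s_def a_def smul_add smul_diff smul_mult_left smul_mult_right
          algebra_simps)
  qed
qed

subsection \<open>Third order deformations\<close>

lemma hcong_iff: "hcong n a b \<longleftrightarrow> (\<forall>k<n. fps_nth a k = fps_nth b k)"
proof
  assume "hcong n a b"
  then obtain c where "a - b = fps_X ^ n * c" unfolding hcong_def by (elim dvdE)
  then have "fps_nth (a - b) k = 0" if "k < n" for k using that by (simp add: fps_X_power_mult_nth)
  then show "\<forall>k<n. fps_nth a k = fps_nth b k" by simp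
next
  assume *: "\<forall>k<n. fps_nth a k = fps_nth b k"
  have "a - b = fps_X ^ n * fps_shift n (a - b)"
    by (rule fps_ext) (use * in \<open>auto simp: fps_X_power_mult_nth\<close>)
  then show "hcong n a b" unfolding hcong_def by (rule dvdI)
qed

lemma less_4_cases: "(\<forall>k<3 + 1. P (k::nat)) \<longleftrightarrow> P 0 \<and> P (Suc 0) \<and> P 2 \<and> P 3"
  by (auto simp: less_Suc_eq eval_nat_numeral)

lemma star_nth:
  "fps_nth (star [\<phi>0, \<phi>1, \<phi>2, \<phi>3] a b) 0 = \<phi>0 (fps_nth a 0) (fps_nth b 0)"
  "fps_nth (star [\<phi>0, \<phi>1, \<phi>2, \<phi>3] a b) (Suc 0) =
     \<phi>0 (fps_nth a 0) (fps_nth b 1) + \<phi>0 (fps_nth a 1) (fps_nth b 0) + \<phi>1 (fps_nth a 0) (fps_nth b 0)"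
  "fps_nth (star [\<phi>0, \<phi>1, \<phi>2, \<phi>3] a b) 2 =
     \<phi>0 (fps_nth a 0) (fps_nth b 2) + \<phi>0 (fps_nth a 1) (fps_nth b 1) + \<phi>0 (fps_nth a 2) (fps_nth b 0) +
     \<phi>1 (fps_nth a 0) (fps_nth b 1) + \<phi>1 (fps_nth a 1) (fps_nth b 0) + \<phi>2 (fps_nth a 0) (fps_nth b 0)"
  "fps_nth (star [\<phi>0, \<phi>1, \<phi>2, \<phi>3] a b) 3 =
     \<phi>0 (fps_nth a 0) (fps_nth b 3) + \<phi>0 (fps_nth a 1) (fps_nth b 2) + \<phi>0 (fps_nth a 2) (fps_nth b 1) +
     \<phi>0 (fps_nth a 3) (fps_nth b 0) +
     \<phi>1 (fps_nth a 0) (fps_nth b 2) + \<phi>1 (fps_nth a 1) (fps_nth b 1) + \<phi>1 (fps_nth a 2) (fps_nth b 0) +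
     \<phi>2 (fps_nth a 0) (fps_nth b 1) + \<phi>2 (fps_nth a 1) (fps_nth b 0) + \<phi>3 (fps_nth a 0) (fps_nth b 0)"
  by (simp_all add: star_def hext_def fps_sum_nth fps_X_power_mult_nth eval_nat_numeral lessThan_Suc
      algebra_simps)

lemma cochain_mult: "is_cochain2 (*)"
  by (rule cochainI) (simp_all add: algebra_simps smul_mult_left smul_mult_right)

text \<open>The three conditions are the coefficients of h, h^2 and h^3 of associativity on
  constants. They suffice for all power series because the products are extended bilinearly.\<close>

lemma deformation_3_iff:
  assumes "is_cochain2 \<phi>1" "is_cochain2 \<phi>2" "is_cochain2 \<phi>3"
  shows "deformation 3 [(*), \<phi>1, \<phi>2, \<phi>3] \<longleftrightarrow>
     (\<forall>p q r. hochschild \<phi>1 p q r = 0) \<and>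
     (\<forall>p q r. hochschild \<phi>2 p q r = \<phi>1 (\<phi>1 p q) r - \<phi>1 p (\<phi>1 q r)) \<and>
     (\<forall>p q r. hochschild \<phi>3 p q r = gbracket \<phi>1 \<phi>2 p q r)" (is "_ \<longleftrightarrow> ?R")
proof
  note [simp] = cochain_simps[OF assms(1)] cochain_simps[OF assms(2)] cochain_simps[OF assms(3)]
  {
    assume "deformation 3 [(*), \<phi>1, \<phi>2, \<phi>3]"
    then have "hcong (3 + 1) (star [(*), \<phi>1, \<phi>2, \<phi>3] (star [(*), \<phi>1, \<phi>2, \<phi>3] (fps_const p) (fps_const q)) (fps_const r))
        (star [(*), \<phi>1, \<phi>2, \<phi>3] (fps_const p) (star [(*), \<phi>1, \<phi>2, \<phi>3] (fps_const q) (fps_const r)))" for p q r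
      unfolding deformation_def by blast
    then have *: "\<phi>1 (p * q) r + \<phi>1 p q * r = \<phi>1 p (q * r) + p * \<phi>1 q r"
      "\<phi>2 (p * q) r + \<phi>1 (\<phi>1 p q) r + \<phi>2 p q * r = \<phi>2 p (q * r) + \<phi>1 p (\<phi>1 q r) + p * \<phi>2 q r"
      "\<phi>3 (p * q) r + \<phi>1 (\<phi>2 p q) r + \<phi>2 (\<phi>1 p q) r + \<phi>3 p q * r =
       \<phi>3 p (q * r) + \<phi>1 p (\<phi>2 q r) + \<phi>2 p (\<phi>1 q r) + p * \<phi>3 q r" for p q r
      unfolding hcong_iff less_4_cases by (simp_all add: star_nth add_ac)
    show ?R
    proof (intro conjI allI)
      fix p q r
      show "hochschild \<phi>1 p q r = 0" using *(1)[of p q r]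
        by (simp add: hochschild_def algebra_simps)
      show "hochschild \<phi>2 p q r = \<phi>1 (\<phi>1 p q) r - \<phi>1 p (\<phi>1 q r)" using *(2)[of p q r]
        by (simp add: hochschild_def algebra_simps)
      show "hochschild \<phi>3 p q r = gbracket \<phi>1 \<phi>2 p q r" using *(3)[of p q r]
        by (simp add: hochschild_def gbracket_def algebra_simps)
    qed
  }
  assume R: ?R
  \<comment> \<open>Oriented so as to remove a product from the first argument; both ways of
    bracketing then reach the same normal form.\<close>
  have 1: "\<phi>1 (p * q) r = p * \<phi>1 q r + \<phi>1 p (q * r) - \<phi>1 p q * r"
    and 2: "\<phi>2 (p * q) r = p * \<phi>2 q r + \<phi>2 p (q * r) - \<phi>2 p q * r - \<phi>1 (\<phi>1 p q) r + \<phi>1 p (\<phi>1 q r)"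
    and 3: "\<phi>3 (p * q) r = p * \<phi>3 q r + \<phi>3 p (q * r) - \<phi>3 p q * r
      - \<phi>1 (\<phi>2 p q) r + \<phi>1 p (\<phi>2 q r) - \<phi>2 (\<phi>1 p q) r + \<phi>2 p (\<phi>1 q r)" for p q r
    using R[THEN conjunct1, rule_format, of p q r] R[THEN conjunct2, THEN conjunct1, rule_format, of p q r]
      R[THEN conjunct2, THEN conjunct2, rule_format, of p q r]
    by (simp_all add: hochschild_def gbracket_def algebra_simps)
  have "hcong (3 + 1) (star [(*), \<phi>1, \<phi>2, \<phi>3] (star [(*), \<phi>1, \<phi>2, \<phi>3] a b) c)
        (star [(*), \<phi>1, \<phi>2, \<phi>3] a (star [(*), \<phi>1, \<phi>2, \<phi>3] b c))" for a b c
    unfolding hcong_iff less_4_cases star_nth by (simp add: 1 2 3 star_nth distrib_left distrib_right mult.assoc)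
  then show "deformation 3 [(*), \<phi>1, \<phi>2, \<phi>3]"
    using assms cochain_mult by (simp add: deformation_def)
qed

section \<open>Power series with polynomial coefficients and gauge transformations\<close>

lemma single_0_sum: "Poly_Mapping.single 0 (sum f A) = (\<Sum>x\<in>A. Poly_Mapping.single 0 (f x))"
  by (induction A rule: infinite_finite_induct) (simp_all add: single_add)

lemma hsmul_nth: "fps_nth (hsmul c a) n = (\<Sum>i=0..n. smul (fps_nth c i) (fps_nth a (n - i)))"
  by (simp add: hsmul_def smul_def fps_mult_nth)

lemma module_hsmul: "module hsmul"
proof
  fix c d :: "'f::field_char_0 fps" and a b :: "('i, 'f) mpoly fps"
  show "hsmul c (a + b) = hsmul c a + hsmul c b"
    by (simp add: hsmul_def distrib_left)
  show "hsmul (c + d) a = hsmul c a + hsmul d a"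
    by (rule fps_ext) (simp add: hsmul_nth smul_add_left sum.distrib)
  have "Abs_fps (\<lambda>n. Poly_Mapping.single 0 (fps_nth c n)) * Abs_fps (\<lambda>n. Poly_Mapping.single 0 (fps_nth d n)) =
      (Abs_fps (\<lambda>n. Poly_Mapping.single 0 (fps_nth (c * d) n)) :: ('i, 'f) mpoly fps)"
    by (rule fps_ext) (simp add: fps_mult_nth single_0_sum mult_single)
  then show "hsmul c (hsmul d a) = hsmul (c * d) a"
    by (simp add: hsmul_def flip: mult.assoc)
  show "hsmul 1 a = a"
  proof (rule fps_ext)
    fix n
    have "fps_nth (hsmul 1 a) n = (\<Sum>i=0..n. if i = 0 then fps_nth a (n - i) else 0)"
      unfolding hsmul_nth by (rule sum.cong) auto
    then show "fps_nth (hsmul 1 a) n = fps_nth a n" by simp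
  qed
qed

text \<open>The coefficients of the product obtained by transport along \<open>p \<mapsto> p + h\<^sup>2 F p\<close>.\<close>

lemma gauge_equivalence:
  assumes def: "deformation 3 [(*), \<phi>1, \<phi>2, \<phi>3]" and F: "lin F"
    and \<psi>2: "\<And>p q. \<psi>2 p q = \<phi>2 p q - (p * F q - F (p * q) + F p * q)"
    and \<psi>3: "\<And>p q. \<psi>3 p q = \<phi>3 p q + F (\<phi>1 p q) - \<phi>1 (F p) q - \<phi>1 p (F q)"
  shows "equivalent_deformations 3 [(*), \<phi>1, \<phi>2, \<phi>3] [(*), \<phi>1, \<psi>2, \<psi>3]"
proof -
  have c: "is_cochain2 \<phi>1" "is_cochain2 \<phi>2" "is_cochain2 \<phi>3"
    using def by (auto simp: deformation_def)
  note F_simps = lin_add[OF F] lin_smul[OF F] lin_diff[OF F] lin_0[OF F]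
  note c_simps = cochain_simps[OF c(1)] cochain_simps[OF c(2)] cochain_simps[OF c(3)]
  have c': "is_cochain2 \<psi>2" "is_cochain2 \<psi>3"
    by (rule cochainI; simp add: \<psi>2 \<psi>3 F_simps c_simps algebra_simps smul_add smul_diff
        smul_mult_left smul_mult_right)+
  have R: "hochschild \<phi>1 p q r = 0" "hochschild \<phi>2 p q r = \<phi>1 (\<phi>1 p q) r - \<phi>1 p (\<phi>1 q r)"
    "hochschild \<phi>3 p q r = gbracket \<phi>1 \<phi>2 p q r" for p q r
    using def deformation_3_iff[OF c] by blast+
  have def': "deformation 3 [(*), \<phi>1, \<psi>2, \<psi>3]"
    unfolding deformation_3_iff[OF c(1) c']
  proof (intro conjI allI)
    fix p q r
    show "hochschild \<phi>1 p q r = 0" by (fact R(1))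
    show "hochschild \<psi>2 p q r = \<phi>1 (\<phi>1 p q) r - \<phi>1 p (\<phi>1 q r)"
      unfolding R(2)[symmetric] by (simp add: hochschild_def \<psi>2 F_simps algebra_simps)
    \<comment> \<open>The third order equation changes only by coboundaries of \<phi>1, which
      vanish.\<close>
    have "hochschild \<psi>3 p q r - gbracket \<phi>1 \<psi>2 p q r = hochschild \<phi>3 p q r - gbracket \<phi>1 \<phi>2 p q r
        + F (hochschild \<phi>1 p q r) - hochschild \<phi>1 (F p) q r - hochschild \<phi>1 p (F q) r
        - hochschild \<phi>1 p q (F r)"
      by (simp add: hochschild_def gbracket_def \<psi>2 \<psi>3 F_simps c_simps algebra_simps)
    then show "hochschild \<psi>3 p q r = gbracket \<phi>1 \<psi>2 p q r"
      by (simp add: R F_simps)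
  qed
  define Fh where "Fh a = a + fps_X ^ 2 * Abs_fps (\<lambda>n. F (fps_nth a n))" for a
  have Fh_nth: "fps_nth (Fh a) n = fps_nth a n + (if n < 2 then 0 else F (fps_nth a (n - 2)))" for a n
    by (simp add: Fh_def fps_X_power_mult_nth)
  have "module_hom hsmul hsmul Fh"
  proof -
    have "Fh (a + b) = Fh a + Fh b" for a b
      by (rule fps_ext) (simp add: Fh_nth F_simps)
    moreover have "Fh (hsmul s a) = hsmul s (Fh a)" for s a
    proof -
      have "Abs_fps (\<lambda>n. F (fps_nth (hsmul s a) n)) = hsmul s (Abs_fps (\<lambda>n. F (fps_nth a n)))"
        by (rule fps_ext) (simp add: hsmul_nth lin_sum[OF F] F_simps)
      then show ?thesis by (simp add: Fh_def hsmul_def algebra_simps)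
    qed
    ultimately show ?thesis
      using module_hsmul by (auto simp: module_hom_def module_hom_axioms_def)
  qed
  moreover have "hcong 1 (Fh (fps_const p)) (fps_const p)" for p
    by (simp add: hcong_iff Fh_nth)
  \<comment> \<open>The quadratic term \<open>F p * F q\<close> has order h^4 and is not seen modulo
    h^4.\<close>
  moreover have "hcong (3 + 1) (Fh (star [(*), \<phi>1, \<phi>2, \<phi>3] (fps_const p) (fps_const q)))
      (star [(*), \<phi>1, \<psi>2, \<psi>3] (Fh (fps_const p)) (Fh (fps_const q)))" for p q
    unfolding hcong_iff less_4_cases
    by (simp add: Fh_nth star_nth c_simps cochain_simps[OF c'(1)] \<psi>2 \<psi>3 F_simps)
  ultimately show ?thesis
    unfolding equivalent_deformations_def using def def' by blast
qed

text \<open>Reversing the arguments changes the sign of the differential of a symmetric cochain and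
  preserves that of an antisymmetric one; the bracket of two antisymmetric cochains changes its
  sign.  Hence the symmetric part of the third order correction absorbs the obstruction, and the
  antisymmetric part is a cocycle.\<close>

lemma classification:
  assumes base: "deformation 3 [(*), \<phi>1, \<pi>2, \<pi>3]" and extension: "deformation 3 [(*), \<phi>1, \<chi>2, \<chi>3]"
    and anti1: "antisymmetric \<phi>1"
  obtains \<phi>2 \<phi>3 \<psi>3 where "antisymmetric \<phi>2" "biderivation \<phi>2" "antisymmetric \<phi>3" "biderivation \<phi>3"
    "is_cochain2 \<psi>3" "symmetric \<psi>3" "hochschild \<psi>3 = gbracket \<phi>1 \<phi>2"
    "equivalent_deformations 3 [(*), \<phi>1, \<chi>2, \<chi>3]
       [(*), \<phi>1, \<lambda>p q. \<pi>2 p q + \<phi>2 p q, \<lambda>p q. \<pi>3 p q + \<phi>3 p q + \<psi>3 p q]"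
proof -
  have c: "is_cochain2 \<phi>1" "is_cochain2 \<pi>2" "is_cochain2 \<pi>3" "is_cochain2 \<chi>2" "is_cochain2 \<chi>3"
    using base extension by (auto simp: deformation_def)
  have R: "hochschild \<pi>2 p q r = \<phi>1 (\<phi>1 p q) r - \<phi>1 p (\<phi>1 q r)"
    "hochschild \<pi>3 p q r = gbracket \<phi>1 \<pi>2 p q r"
    "hochschild \<chi>2 p q r = \<phi>1 (\<phi>1 p q) r - \<phi>1 p (\<phi>1 q r)" for p q r
    using base extension deformation_3_iff[OF c(1,2,3)] deformation_3_iff[OF c(1,4,5)] by blast+
  \<comment> \<open>Both second order terms solve the same equation, whose right side depends on
    \<phi>1 only; their difference is a cocycle.\<close>
  define d where "d p q = \<chi>2 p q - \<pi>2 p q" for p q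
  have d: "is_cochain2 d"
    by (rule cochainI) (simp_all add: d_def cochain_simps[OF c(2)] cochain_simps[OF c(4)] smul_diff)
  have d0: "hochschild d p q r = 0" for p q r
    using R(1,3)[of p q r] by (simp add: d_def[abs_def] hochschild_difference)
  obtain s a where s: "is_cochain2 s" "symmetric s" and a: "is_cochain2 a" "antisymmetric a"
    and d_eq: "d = (\<lambda>p q. s p q + a p q)"
    and hs: "\<And>p q r. hochschild s p q r = smul (1/2) (hochschild d p q r - hochschild d r q p)"
    and ha: "\<And>p q r. hochschild a p q r = smul (1/2) (hochschild d p q r + hochschild d r q p)"
    by (rule cochain_split[OF d]) (rule that)
  have hs0: "hochschild s p q r = 0" and "hochschild a p q r = 0" for p q r
    by (simp_all add: hs ha d0)
  with a antisymmetric_cocycle_biderivation have a': "biderivation a" by blast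
  obtain F where F: "lin F" "\<And>p q. s p q = p * F q - F (p * q) + F p * q"
    by (rule symmetric_cocycle_coboundary[OF s hs0]) (rule that)
  define \<chi>3' where "\<chi>3' p q = \<chi>3 p q + F (\<phi>1 p q) - \<phi>1 (F p) q - \<phi>1 p (F q)" for p q
  let ?\<chi>2' = "\<lambda>p q. \<pi>2 p q + a p q"
  have eq: "equivalent_deformations 3 [(*), \<phi>1, \<chi>2, \<chi>3] [(*), \<phi>1, ?\<chi>2', \<chi>3']"
  proof (rule gauge_equivalence[OF extension F(1)])
    show "?\<chi>2' p q = \<chi>2 p q - (p * F q - F (p * q) + F p * q)" for p q
      using fun_cong[OF fun_cong[OF d_eq], of p q] unfolding F(2)[symmetric] d_def
      by (simp add: algebra_simps)
  qed (fact \<chi>3'_def)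
  then have def': "deformation 3 [(*), \<phi>1, ?\<chi>2', \<chi>3']"
    by (simp add: equivalent_deformations_def)
  then have c': "is_cochain2 \<chi>3'" "is_cochain2 ?\<chi>2'"
    by (auto simp: deformation_def)
  define e where "e p q = \<chi>3' p q - \<pi>3 p q" for p q
  have e: "is_cochain2 e"
    by (rule cochainI) (simp_all add: e_def cochain_simps[OF c(3)] cochain_simps[OF c'(1)] smul_diff)
  have he: "hochschild e p q r = gbracket \<phi>1 a p q r" for p q r
  proof -
    have "hochschild \<chi>3' p q r = gbracket \<phi>1 ?\<chi>2' p q r"
      using def' deformation_3_iff[OF c(1) c'(2,1)] by blast
    then show ?thesis
      using R(2)[of p q r] by (simp add: e_def[abs_def] hochschild_difference gbracket_def cochain_simps[OF c(1)])
  qed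
  have rev: "gbracket \<phi>1 a r q p = - gbracket \<phi>1 a p q r" for p q r
  proof -
    have A: "\<phi>1 p q = - \<phi>1 q p" "a p q = - a q p" for p q
      using anti1 a(2) unfolding antisymmetric_def by blast+
    have "\<phi>1 (a x y) z = \<phi>1 z (a y x)" "a (\<phi>1 x y) z = a z (\<phi>1 y x)" for x y z
      using A(1)[of "a x y" z] A(2)[of x y] A(2)[of "\<phi>1 x y" z] A(1)[of x y]
      by (simp_all add: cochain_simps[OF c(1)] cochain_simps[OF a(1)])
    then show ?thesis by (simp add: gbracket_def)
  qed
  \<comment> \<open>The symmetric part of the third order difference is kept as \<psi>3, since its
    coboundary is the bracket of \<phi>1 with \<open>a\<close>; the antisymmetric part becomes
    \<phi>3.\<close>
  obtain s' a' where s': "is_cochain2 s'" "symmetric s'" and a'': "is_cochain2 a'" "antisymmetric a'"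
    and e_eq: "e = (\<lambda>p q. s' p q + a' p q)"
    and hs': "\<And>p q r. hochschild s' p q r = smul (1/2) (hochschild e p q r - hochschild e r q p)"
    and ha': "\<And>p q r. hochschild a' p q r = smul (1/2) (hochschild e p q r + hochschild e r q p)"
    by (rule cochain_split[OF e]) (rule that)
  have hs'': "hochschild s' = gbracket \<phi>1 a"
  proof (intro ext)
    show "hochschild s' p q r = gbracket \<phi>1 a p q r" for p q r
      unfolding hs' he rev[of r q p] by (simp add: numeral_smul flip: smul_mult_right)
  qed
  have "hochschild a' p q r = 0" for p q r
    unfolding ha' he rev[of r q p] by simp
  with a'' antisymmetric_cocycle_biderivation have "biderivation a'" by blast
  moreover have "\<chi>3' = (\<lambda>p q. \<pi>3 p q + a' p q + s' p q)"
  proof (intro ext)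
    show "\<chi>3' p q = \<pi>3 p q + a' p q + s' p q" for p q
      using fun_cong[OF fun_cong[OF e_eq], of p q] by (simp add: e_def algebra_simps)
  qed
  ultimately show ?thesis
    using that[OF a(2) a' a''(2) _ s' hs''] eq by simp
qed

text \<open>Biderivations are closed, so \<phi>2 leaves the second order equation intact and \<phi>3
  the third. The bracket is additive in \<phi>2, and its extra term is exactly the coboundary of
  \<psi>3.\<close>

lemma deformation_perturbation:
  assumes base: "deformation 3 [(*), \<phi>1, \<pi>2, \<pi>3]"
    and \<phi>2: "biderivation \<phi>2" and \<phi>3: "biderivation \<phi>3"
    and \<psi>3: "is_cochain2 \<psi>3" "hochschild \<psi>3 = gbracket \<phi>1 \<phi>2"
  shows "deformation 3 [(*), \<phi>1, \<lambda>p q. \<pi>2 p q + \<phi>2 p q, \<lambda>p q. \<pi>3 p q + \<phi>3 p q + \<psi>3 p q]"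
proof -
  have c: "is_cochain2 \<phi>1" "is_cochain2 \<pi>2" "is_cochain2 \<pi>3"
    using base by (auto simp: deformation_def)
  have c': "is_cochain2 (\<lambda>p q. \<pi>2 p q + \<phi>2 p q)" "is_cochain2 (\<lambda>p q. \<pi>3 p q + \<phi>3 p q + \<psi>3 p q)"
    using c \<phi>2 \<phi>3 \<psi>3 by (auto intro!: cochain_sum simp: biderivation_def)
  from base show ?thesis
    unfolding deformation_3_iff[OF c] deformation_3_iff[OF c(1) c']
    by (simp add: hochschild_sum biderivation_hochschild[OF \<phi>2] biderivation_hochschild[OF \<phi>3] \<psi>3(2)
        gbracket_def cochain_simps[OF c(1)])
qed

subsection \<open>Finite forms of the explicit formula\<close>

lemma Sum_any_2:
  fixes f :: "'i \<Rightarrow> 'i \<Rightarrow> 'b::comm_monoid_add"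
  assumes "finite A1" "finite A2" and "\<And>i j. f i j \<noteq> 0 \<Longrightarrow> i \<in> A1 \<and> j \<in> A2"
  shows "Sum_any (\<lambda>(i, j). f i j) = (\<Sum>i\<in>A1. \<Sum>j\<in>A2. f i j)"
proof -
  have "Sum_any (\<lambda>(i, j). f i j) = sum (\<lambda>(i, j). f i j) (A1 \<times> A2)"
    by (rule Sum_any.expand_superset) (use assms in auto)
  then show ?thesis by (simp add: sum.cartesian_product)
qed

lemma Sum_any_4:
  fixes f :: "'i \<Rightarrow> 'i \<Rightarrow> 'i \<Rightarrow> 'i \<Rightarrow> 'b::comm_monoid_add"
  assumes "finite A1" "finite A2" "finite A3" "finite A4"
    and "\<And>i j k l. f i j k l \<noteq> 0 \<Longrightarrow> i \<in> A1 \<and> j \<in> A2 \<and> k \<in> A3 \<and> l \<in> A4"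
  shows "Sum_any (\<lambda>(i, j, k, l). f i j k l) = (\<Sum>i\<in>A1. \<Sum>j\<in>A2. \<Sum>k\<in>A3. \<Sum>l\<in>A4. f i j k l)"
proof -
  have "Sum_any (\<lambda>(i, j, k, l). f i j k l) = sum (\<lambda>(i, j, k, l). f i j k l) (A1 \<times> A2 \<times> A3 \<times> A4)"
    by (rule Sum_any.expand_superset) (use assms in auto)
  then show ?thesis by (simp add: sum.cartesian_product)
qed

lemma Sum_any_6:
  fixes f :: "'i \<Rightarrow> 'i \<Rightarrow> 'i \<Rightarrow> 'i \<Rightarrow> 'i \<Rightarrow> 'i \<Rightarrow> 'b::comm_monoid_add"
  assumes "finite A1" "finite A2" "finite A3" "finite A4" "finite A5" "finite A6"
    and "\<And>i j k l m n. f i j k l m n \<noteq> 0 \<Longrightarrow>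
      i \<in> A1 \<and> j \<in> A2 \<and> k \<in> A3 \<and> l \<in> A4 \<and> m \<in> A5 \<and> n \<in> A6"
  shows "Sum_any (\<lambda>(i, j, k, l, m, n). f i j k l m n) =
    (\<Sum>i\<in>A1. \<Sum>j\<in>A2. \<Sum>k\<in>A3. \<Sum>l\<in>A4. \<Sum>m\<in>A5. \<Sum>n\<in>A6. f i j k l m n)"
proof -
  have "Sum_any (\<lambda>(i, j, k, l, m, n). f i j k l m n) =
      sum (\<lambda>(i, j, k, l, m, n). f i j k l m n) (A1 \<times> A2 \<times> A3 \<times> A4 \<times> A5 \<times> A6)"
    by (rule Sum_any.expand_superset) (use assms in auto)
  then show ?thesis by (simp add: sum.cartesian_product)
qed

lemma D_simps: "D [] p = p" "D (i # is) p = pderiv_var i (D is p)"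
  by (simp_all add: D_def)

section \<open>Calculus of a fixed Poisson bracket\<close>

locale poisson =
  fixes B :: "('i, 'f::field_char_0) cochain2" and X :: "'i \<Rightarrow> 'i \<Rightarrow> ('i, 'f) mpoly"
  assumes poisson: "poisson_bracket B" and X: "X i j = B (gen i) (gen j)"
begin

lemma cochain_B: "is_cochain2 B"
  using poisson by (simp add: poisson_bracket_def biderivation_def)

lemmas B_simps = cochain_simps[OF cochain_B]

lemma B_sum1: "B (sum u A) v = (\<Sum>x\<in>A. B (u x) v)"
  and B_sum2: "B v (sum u A) = (\<Sum>x\<in>A. B v (u x))"
  using lin_sum[OF cochain_lin1[OF cochain_B]] lin_sum[OF cochain_lin2[OF cochain_B]] by auto

lemma B_anti: "B p q = - B q p"
  using poisson unfolding poisson_bracket_def antisymmetric_def by blast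

lemma B_self: "B p p = 0"
proof -
  have "B p p + B p p = 0" using B_anti[of p p] by (metis add.right_inverse)
  then have "of_nat (Suc 1) * B p p = 0" by simp
  then show ?thesis by (rule of_nat_Suc_mult_eq_0)
qed

lemma B_mult1: "B (p * q) r = p * B q r + B p r * q"
  and B_mult2: "B p (q * r) = q * B p r + B p q * r"
  using poisson unfolding poisson_bracket_def biderivation_def by blast+

text \<open>The form in which bracketing with \<open>r\<close> is a derivation of the bracket; it
  moves \<open>r\<close> inwards.\<close>

lemma Jacobi: "B (B p q) r = B (B p r) q + B p (B q r)"
proof -
  have "B p (B q r) + B q (B r p) + B r (B p q) = 0"
    using poisson by (simp add: poisson_bracket_def)
  moreover have "B r (B p q) = - B (B p q) r" "B q (B r p) = B (B p r) q"
    using B_anti[of r "B p q"] B_anti[of q "B r p"] B_anti[of r p] by (simp_all add: B_simps)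
  ultimately show ?thesis by (simp add: algebra_simps)
qed

lemma derivation_B1: "derivation (\<lambda>p. B p q)"
  and derivation_B2: "derivation (B p)"
  by (auto simp: derivation_def cochain_lin1[OF cochain_B] cochain_lin2[OF cochain_B] B_mult1 B_mult2)

lemma B_chain1: "finite S \<Longrightarrow> vars p \<subseteq> S \<Longrightarrow> B p q = (\<Sum>i\<in>S. pderiv_var i p * B (gen i) q)"
  and B_chain2: "finite S \<Longrightarrow> vars q \<subseteq> S \<Longrightarrow> B p q = (\<Sum>i\<in>S. pderiv_var i q * B p (gen i))"
  using derivation_eq_sum[OF derivation_B1] derivation_eq_sum[OF derivation_B2] by auto

lemma B_expand:
  assumes "finite S" "vars p \<subseteq> S" "finite T" "vars q \<subseteq> T"
  shows "B p q = (\<Sum>i\<in>S. \<Sum>j\<in>T. pderiv_var i p * X i j * pderiv_var j q)"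
  unfolding B_chain1[OF assms(1,2)] B_chain2[OF assms(3,4), of "gen _"] X
  by (simp add: sum_distrib_left mult_ac)

lemma pi1_eq: "pi1 X p q = smul (1/2) (B p q)"
proof -
  have "Sum_any (\<lambda>(i, j). X i j * DD [i] [j] p q) = (\<Sum>i\<in>vars p. \<Sum>j\<in>vars q. X i j * DD [i] [j] p q)"
    by (rule Sum_any_2[OF finite_vars finite_vars]) (auto simp: DD_def D_simps vars_def)
  also have "\<dots> = B p q"
    by (simp add: B_expand[of "vars p" p "vars q" q] DD_def D_simps mult_ac)
  finally show ?thesis by (simp add: pi1_def)
qed

text \<open>In each term one factor X has both indices on derivatives of other factors, so
  \<open>B_expand\<close> turns it into a bracket and two indices disappear. Any \<open>T\<close>
  large enough is allowed, so that several arguments can share one index set.\<close>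

lemma pi2_eq:
  assumes T: "finite T" "vars p \<subseteq> T" "vars q \<subseteq> T"
  shows "24 * pi2 X p q = (\<Sum>i\<in>T. \<Sum>j\<in>T.
      2 * (pderiv_var i p * B (X i j) (pderiv_var j q) + pderiv_var i q * B (X i j) (pderiv_var j p)) +
      3 * (X i j * B (pderiv_var i p) (pderiv_var j q)))"
proof -
  \<comment> \<open>The index \<open>l\<close> differentiates \<open>X i j\<close> rather than
    \<open>p\<close> or \<open>q\<close>, so its range comes from the variables of the structure
    polynomials.\<close>
  define S where "S = (\<Union>i\<in>T. \<Union>j\<in>T. vars (X i j))"
  have S: "finite S" "\<And>i j. i \<in> T \<Longrightarrow> j \<in> T \<Longrightarrow> vars (X i j) \<subseteq> S" using T(1) by (auto simp: S_def)
  have pT: "pderiv_var i p = 0" if "i \<notin> T" for i using not_in_vars[of i p] that T(2) by blast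
  have qT: "pderiv_var i q = 0" if "i \<notin> T" for i using not_in_vars[of i q] that T(3) by blast
  have comm: "pderiv_var i (pderiv_var j u) = 0" if "pderiv_var j u = 0 \<or> pderiv_var i u = 0" for i j u
    using that by (metis pderiv_var_0 pderiv_var_commute)
  have XS: "pderiv_var l (X i j) = 0" if "l \<notin> S" "i \<in> T" "j \<in> T" for i j l
    using not_in_vars[of l "X i j"] that S(2) by blast
  have vT: "vars (pderiv_var i p) \<subseteq> T" "vars (pderiv_var i q) \<subseteq> T" for i
    by (intro subset_trans[OF vars_pderiv_var] T(2,3))+
  have a: "Sum_any (\<lambda>(i, j, k, l). D [l] (X i j) * X l k * (DD [i] [j, k] p q + DD [j, k] [i] p q)) =
      (\<Sum>i\<in>T. \<Sum>j\<in>T. \<Sum>k\<in>T. \<Sum>l\<in>S. D [l] (X i j) * X l k * (DD [i] [j, k] p q + DD [j, k] [i] p q))"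
    by (rule Sum_any_4[OF T(1) T(1) T(1) S(1)])
      (metis (no_types, lifting) DD_def D_simps XS pT qT comm add_0 mult_zero_left mult_zero_right)
  have b: "Sum_any (\<lambda>(i, j, k, l). X i j * X k l * DD [i, k] [j, l] p q) =
      (\<Sum>i\<in>T. \<Sum>j\<in>T. \<Sum>k\<in>T. \<Sum>l\<in>T. X i j * X k l * DD [i, k] [j, l] p q)"
    by (rule Sum_any_4[OF T(1) T(1) T(1) T(1)])
      (metis (no_types, lifting) DD_def D_simps pT qT comm mult_zero_left mult_zero_right)
  have a': "(\<Sum>k\<in>T. \<Sum>l\<in>S. D [l] (X i j) * X l k * (DD [i] [j, k] p q + DD [j, k] [i] p q)) =
      pderiv_var i p * B (X i j) (pderiv_var j q) + pderiv_var i q * B (X i j) (pderiv_var j p)"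
    if "i \<in> T" "j \<in> T" for i j
    unfolding B_expand[OF S(1) S(2)[OF that] T(1) vT(1)] B_expand[OF S(1) S(2)[OF that] T(1) vT(2)]
    by (subst (1) sum.swap, simp add: sum_distrib_left DD_def D_simps distrib_left sum.distrib
        pderiv_var_commute[of _ j] mult_ac)
  have b': "(\<Sum>k\<in>T. \<Sum>l\<in>T. X i j * X k l * DD [i, k] [j, l] p q) = X i j * B (pderiv_var i p) (pderiv_var j q)"
    for i j
    unfolding B_expand[OF T(1) vT(1) T(1) vT(2)]
    by (simp add: sum_distrib_left DD_def D_simps pderiv_var_commute[of i] pderiv_var_commute[of j] mult_ac)
  have "24 * pi2 X p q = 2 * (\<Sum>i\<in>T. \<Sum>j\<in>T. \<Sum>k\<in>T. \<Sum>l\<in>S. D [l] (X i j) * X l k * (DD [i] [j, k] p q + DD [j, k] [i] p q))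
     + 3 * (\<Sum>i\<in>T. \<Sum>j\<in>T. \<Sum>k\<in>T. \<Sum>l\<in>T. X i j * X k l * DD [i, k] [j, l] p q)"
    by (simp add: pi2_def a b numeral_smul)
  also have "\<dots> = (\<Sum>i\<in>T. \<Sum>j\<in>T.
      2 * (pderiv_var i p * B (X i j) (pderiv_var j q) + pderiv_var i q * B (X i j) (pderiv_var j p)) +
      3 * (X i j * B (pderiv_var i p) (pderiv_var j q)))"
    by (simp add: a' b' sum.distrib sum_distrib_left cong: sum.cong)
  finally show ?thesis .
qed

text \<open>Again one X per sum is absorbed into a bracket, which leaves four of the six
  indices.\<close>

lemma pi3_eq:
  assumes T: "finite T" "vars p \<subseteq> T" "vars q \<subseteq> T"
    and finS: "finite S" and XS: "(\<Union>i\<in>T. \<Union>j\<in>T. vars (X i j)) \<subseteq> S"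
  shows "48 * pi3 X p q =
     2 * (\<Sum>k\<in>S. \<Sum>l\<in>T. \<Sum>m\<in>T. \<Sum>n\<in>T. B (X k l) (pderiv_var k (X m n)) *
           (pderiv_var n p * pderiv_var l (pderiv_var m q) - pderiv_var l (pderiv_var m p) * pderiv_var n q))
     + (\<Sum>i\<in>T. \<Sum>j\<in>T. \<Sum>k\<in>T. \<Sum>l\<in>T. X i j * X k l *
           B (pderiv_var i (pderiv_var k p)) (pderiv_var j (pderiv_var l q)))
     + (\<Sum>l\<in>S. \<Sum>j\<in>T. \<Sum>m\<in>T. \<Sum>n\<in>T. pderiv_var l (X j n) *
           (pderiv_var m (pderiv_var n p) * B (X l m) (pderiv_var j q) -
            pderiv_var m (pderiv_var n q) * B (X l m) (pderiv_var j p)))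
     + (\<Sum>l\<in>S. \<Sum>j\<in>T. \<Sum>m\<in>T. \<Sum>n\<in>T. X l j *
           (pderiv_var m p * B (pderiv_var l (X m n)) (pderiv_var n (pderiv_var j q)) -
            pderiv_var m q * B (pderiv_var l (X m n)) (pderiv_var n (pderiv_var j p))))
     + 2 * (\<Sum>i\<in>T. \<Sum>j\<in>T. \<Sum>m\<in>T. \<Sum>n\<in>T. X m n *
           (B (X i j) (pderiv_var j (pderiv_var m p)) * pderiv_var i (pderiv_var n q) -
            pderiv_var i (pderiv_var n p) * B (X i j) (pderiv_var j (pderiv_var m q))))"
proof -
  have S: "finite S" "\<And>i j. i \<in> T \<Longrightarrow> j \<in> T \<Longrightarrow> vars (X i j) \<subseteq> S" using finS XS by blast+
  \<comment> \<open>Some indices are nested one level deeper: they differentiate an X one of whose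
    own indices already ranges over \<open>S\<close>.\<close>
  define S2 where "S2 = (\<Union>k\<in>S. \<Union>l\<in>T. vars (X k l))"
  have S2: "finite S2" "\<And>k l. k \<in> S \<Longrightarrow> l \<in> T \<Longrightarrow> vars (X k l) \<subseteq> S2" using T(1) S(1) by (auto simp: S2_def)
  have pT: "pderiv_var i p = 0" if "i \<notin> T" for i using not_in_vars[of i p] that T(2) by blast
  have qT: "pderiv_var i q = 0" if "i \<notin> T" for i using not_in_vars[of i q] that T(3) by blast
  have comm: "pderiv_var i (pderiv_var j u) = 0" if "pderiv_var j u = 0 \<or> pderiv_var i u = 0" for i j u
    using that by (metis pderiv_var_0 pderiv_var_commute)
  have XS: "pderiv_var l (X i j) = 0" if "l \<notin> S" "i \<in> T" "j \<in> T" for i j l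
    using not_in_vars[of l "X i j"] that S(2) by blast
  have XS2: "pderiv_var l (X i j) = 0" if "l \<notin> S2" "i \<in> S" "j \<in> T" for i j l
    using not_in_vars[of l "X i j"] that S2(2) by blast
  have vT: "vars (pderiv_var i p) \<subseteq> T" "vars (pderiv_var i q) \<subseteq> T"
    "vars (pderiv_var i (pderiv_var j p)) \<subseteq> T" "vars (pderiv_var i (pderiv_var j q)) \<subseteq> T" for i j
    by (intro subset_trans[OF vars_pderiv_var] T(2,3))+
  have vS: "vars (pderiv_var k (X i j)) \<subseteq> S" if "i \<in> T" "j \<in> T" for i j k
    by (intro subset_trans[OF vars_pderiv_var] S(2) that)
  have d2p: "pderiv_var i (pderiv_var j p) = 0" if "i \<notin> T \<or> j \<notin> T" for i j using that by (metis comm pT)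
  have d2q: "pderiv_var i (pderiv_var j q) = 0" if "i \<notin> T \<or> j \<notin> T" for i j using that by (metis comm qT)
  have d3p: "pderiv_var i (pderiv_var j (pderiv_var k p)) = 0" if "i \<notin> T \<or> j \<notin> T \<or> k \<notin> T" for i j k
    using that comm d2p by (metis pderiv_var_0)
  have d3q: "pderiv_var i (pderiv_var j (pderiv_var k q)) = 0" if "i \<notin> T \<or> j \<notin> T \<or> k \<notin> T" for i j k
    using that comm d2q by (metis pderiv_var_0)
  have XSS: "pderiv_var i (pderiv_var j (X m n)) = 0" if "i \<notin> S \<or> j \<notin> S" "m \<in> T" "n \<in> T" for i j m n
    using that by (metis comm XS)
  have 1: "Sum_any (\<lambda>(i, j, k, l, m, n). X i j * D [i] (X k l) * D [j, k] (X m n) *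
            (DD [n] [l, m] p q - DD [l, m] [n] p q)) =
      (\<Sum>i\<in>S2. \<Sum>j\<in>S. \<Sum>k\<in>S. \<Sum>l\<in>T. \<Sum>m\<in>T. \<Sum>n\<in>T. X i j * D [i] (X k l) * D [j, k] (X m n) *
            (DD [n] [l, m] p q - DD [l, m] [n] p q))"
  \<comment> \<open>The support is bounded from the arguments outwards: indices on \<open>p\<close>
    and \<open>q\<close> lie in \<open>T\<close>, those on X with indices in \<open>T\<close> lie in
    \<open>S\<close>, and the remaining one lies in \<open>S2\<close>.\<close>
  proof (rule Sum_any_6[OF S2(1) S(1) S(1) T(1) T(1) T(1)])
    fix i j k l m n
    assume *: "X i j * D [i] (X k l) * D [j, k] (X m n) * (DD [n] [l, m] p q - DD [l, m] [n] p q) \<noteq> 0"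
    then have lmn: "l \<in> T \<and> m \<in> T \<and> n \<in> T"
      using pT qT d2p d2q unfolding DD_def D_simps by (metis diff_0_right mult_zero_left mult_zero_right)
    with * have jk: "j \<in> S \<and> k \<in> S"
      using XSS unfolding D_simps by (metis mult_zero_left mult_zero_right)
    with * lmn have "i \<in> S2"
      using XS2 unfolding D_simps by (metis mult_zero_left mult_zero_right)
    with lmn jk show "i \<in> S2 \<and> j \<in> S \<and> k \<in> S \<and> l \<in> T \<and> m \<in> T \<and> n \<in> T" by blast
  qed
  have 2: "Sum_any (\<lambda>(i, j, k, l, m, n). X i j * X k l * X m n * DD [i, k, m] [j, l, n] p q) =
      (\<Sum>i\<in>T. \<Sum>j\<in>T. \<Sum>k\<in>T. \<Sum>l\<in>T. \<Sum>m\<in>T. \<Sum>n\<in>T. X i j * X k l * X m n * DD [i, k, m] [j, l, n] p q)"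
    by (rule Sum_any_6[OF T(1) T(1) T(1) T(1) T(1) T(1)])
      (metis (no_types, lifting) DD_def D_simps d3p d3q mult_zero_left mult_zero_right)
  have 3: "Sum_any (\<lambda>(i, j, k, l, m, n). D [k] (X l m) * D [l] (X j n) * X k i *
            (DD [m, n] [i, j] p q - DD [i, j] [m, n] p q)) =
      (\<Sum>i\<in>T. \<Sum>j\<in>T. \<Sum>k\<in>S2. \<Sum>l\<in>S. \<Sum>m\<in>T. \<Sum>n\<in>T. D [k] (X l m) * D [l] (X j n) * X k i *
            (DD [m, n] [i, j] p q - DD [i, j] [m, n] p q))"
  proof (rule Sum_any_6[OF T(1) T(1) S2(1) S(1) T(1) T(1)])
    fix i j k l m n
    assume *: "D [k] (X l m) * D [l] (X j n) * X k i * (DD [m, n] [i, j] p q - DD [i, j] [m, n] p q) \<noteq> 0"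
    then have ijmn: "i \<in> T \<and> j \<in> T \<and> m \<in> T \<and> n \<in> T"
      using d2p d2q unfolding DD_def D_simps by (metis diff_0_right mult_zero_left mult_zero_right)
    with * have l: "l \<in> S" using XS unfolding D_simps by (metis mult_zero_left mult_zero_right)
    with * ijmn have "k \<in> S2" using XS2 unfolding D_simps by (metis mult_zero_left)
    with ijmn l show "i \<in> T \<and> j \<in> T \<and> k \<in> S2 \<and> l \<in> S \<and> m \<in> T \<and> n \<in> T" by blast
  qed
  have 4: "Sum_any (\<lambda>(i, j, k, l, m, n). D [k, l] (X m n) * X l j * X k i *
            (DD [m] [n, i, j] p q - DD [n, i, j] [m] p q)) =
      (\<Sum>i\<in>T. \<Sum>j\<in>T. \<Sum>k\<in>S. \<Sum>l\<in>S. \<Sum>m\<in>T. \<Sum>n\<in>T. D [k, l] (X m n) * X l j * X k i *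
            (DD [m] [n, i, j] p q - DD [n, i, j] [m] p q))"
  proof (rule Sum_any_6[OF T(1) T(1) S(1) S(1) T(1) T(1)])
    fix i j k l m n
    assume *: "D [k, l] (X m n) * X l j * X k i * (DD [m] [n, i, j] p q - DD [n, i, j] [m] p q) \<noteq> 0"
    then have ijmn: "i \<in> T \<and> j \<in> T \<and> m \<in> T \<and> n \<in> T"
      using pT qT d3p d3q unfolding DD_def D_simps by (metis diff_0_right mult_zero_left mult_zero_right)
    with * have "k \<in> S \<and> l \<in> S" using XSS unfolding D_simps by (metis mult_zero_left)
    with ijmn show "i \<in> T \<and> j \<in> T \<and> k \<in> S \<and> l \<in> S \<and> m \<in> T \<and> n \<in> T" by blast
  qed
  have 5: "Sum_any (\<lambda>(i, j, k, l, m, n). D [k] (X i j) * X k l * X m n *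
            (DD [j, l, m] [i, n] p q - DD [i, n] [j, l, m] p q)) =
      (\<Sum>i\<in>T. \<Sum>j\<in>T. \<Sum>k\<in>S. \<Sum>l\<in>T. \<Sum>m\<in>T. \<Sum>n\<in>T. D [k] (X i j) * X k l * X m n *
            (DD [j, l, m] [i, n] p q - DD [i, n] [j, l, m] p q))"
  proof (rule Sum_any_6[OF T(1) T(1) S(1) T(1) T(1) T(1)])
    fix i j k l m n
    assume *: "D [k] (X i j) * X k l * X m n * (DD [j, l, m] [i, n] p q - DD [i, n] [j, l, m] p q) \<noteq> 0"
    then have ijlmn: "i \<in> T \<and> j \<in> T \<and> l \<in> T \<and> m \<in> T \<and> n \<in> T"
      using d2p d2q d3p d3q unfolding DD_def D_simps by (metis diff_0_right mult_zero_left mult_zero_right)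
    with * have "k \<in> S" using XS unfolding D_simps by (metis mult_zero_left)
    with ijlmn show "i \<in> T \<and> j \<in> T \<and> k \<in> S \<and> l \<in> T \<and> m \<in> T \<and> n \<in> T" by blast
  qed
  have e1: "(\<Sum>i\<in>S2. \<Sum>j\<in>S. \<Sum>k\<in>S. \<Sum>l\<in>T. \<Sum>m\<in>T. \<Sum>n\<in>T. X i j * D [i] (X k l) * D [j, k] (X m n) *
            (DD [n] [l, m] p q - DD [l, m] [n] p q)) =
     (\<Sum>k\<in>S. \<Sum>l\<in>T. \<Sum>m\<in>T. \<Sum>n\<in>T. B (X k l) (pderiv_var k (X m n)) *
           (pderiv_var n p * pderiv_var l (pderiv_var m q) - pderiv_var l (pderiv_var m p) * pderiv_var n q))" (is "?L = ?R")
  proof -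
    have "(\<Sum>k\<in>S. \<Sum>l\<in>T. \<Sum>m\<in>T. \<Sum>n\<in>T. B (X k l) (pderiv_var k (X m n)) *
           (pderiv_var n p * pderiv_var l (pderiv_var m q) - pderiv_var l (pderiv_var m p) * pderiv_var n q)) =
      (\<Sum>k\<in>S. \<Sum>l\<in>T. \<Sum>m\<in>T. \<Sum>n\<in>T. \<Sum>i\<in>S2. \<Sum>j\<in>S. X i j * D [i] (X k l) * D [j, k] (X m n) *
            (DD [n] [l, m] p q - DD [l, m] [n] p q))"
      by (intro sum.cong refl)
        (simp add: B_expand[OF S2(1) S2(2) S(1) vS] sum_distrib_left sum_distrib_right DD_def D_simps mult_ac)
    also have "\<dots> = ?L"
      unfolding sum.cartesian_product
      by (rule sum.reindex_bij_witness[where i = "\<lambda>(i, j, k, l, m, n). (k, l, m, n, i, j)"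
            and j = "\<lambda>(k, l, m, n, i, j). (i, j, k, l, m, n)"]) auto
    finally show ?thesis by simp
  qed
  have e2: "(\<Sum>i\<in>T. \<Sum>j\<in>T. \<Sum>k\<in>T. \<Sum>l\<in>T. \<Sum>m\<in>T. \<Sum>n\<in>T. X i j * X k l * X m n * DD [i, k, m] [j, l, n] p q) =
     (\<Sum>i\<in>T. \<Sum>j\<in>T. \<Sum>k\<in>T. \<Sum>l\<in>T. X i j * X k l *
           B (pderiv_var i (pderiv_var k p)) (pderiv_var j (pderiv_var l q)))"
    by (intro sum.cong refl)
      (simp add: B_expand[OF T(1) vT(3) T(1) vT(4)] sum_distrib_left DD_def D_simps mult_ac
        pderiv_var_commute)
  have e3: "(\<Sum>i\<in>T. \<Sum>j\<in>T. \<Sum>k\<in>S2. \<Sum>l\<in>S. \<Sum>m\<in>T. \<Sum>n\<in>T. D [k] (X l m) * D [l] (X j n) * X k i *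
            (DD [m, n] [i, j] p q - DD [i, j] [m, n] p q)) =
     (\<Sum>l\<in>S. \<Sum>j\<in>T. \<Sum>m\<in>T. \<Sum>n\<in>T. pderiv_var l (X j n) *
           (pderiv_var m (pderiv_var n p) * B (X l m) (pderiv_var j q) -
            pderiv_var m (pderiv_var n q) * B (X l m) (pderiv_var j p)))" (is "?L = ?R")
  proof -
    have "?R = (\<Sum>l\<in>S. \<Sum>j\<in>T. \<Sum>m\<in>T. \<Sum>n\<in>T. \<Sum>k\<in>S2. \<Sum>i\<in>T. D [k] (X l m) * D [l] (X j n) * X k i *
            (DD [m, n] [i, j] p q - DD [i, j] [m, n] p q))"
      by (intro sum.cong refl)
        (simp add: B_expand[OF S2(1) S2(2) T(1) vT(1)] B_expand[OF S2(1) S2(2) T(1) vT(2)] sum_distrib_left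
          DD_def D_simps pderiv_var_commute right_diff_distrib sum_subtractf mult_ac)
    also have "\<dots> = ?L"
      unfolding sum.cartesian_product
      by (rule sum.reindex_bij_witness[where i = "\<lambda>(i, j, k, l, m, n). (l, j, m, n, k, i)"
            and j = "\<lambda>(l, j, m, n, k, i). (i, j, k, l, m, n)"]) auto
    finally show ?thesis by simp
  qed
  have e4: "(\<Sum>i\<in>T. \<Sum>j\<in>T. \<Sum>k\<in>S. \<Sum>l\<in>S. \<Sum>m\<in>T. \<Sum>n\<in>T. D [k, l] (X m n) * X l j * X k i *
            (DD [m] [n, i, j] p q - DD [n, i, j] [m] p q)) =
     (\<Sum>l\<in>S. \<Sum>j\<in>T. \<Sum>m\<in>T. \<Sum>n\<in>T. X l j *
           (pderiv_var m p * B (pderiv_var l (X m n)) (pderiv_var n (pderiv_var j q)) -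
            pderiv_var m q * B (pderiv_var l (X m n)) (pderiv_var n (pderiv_var j p))))" (is "?L = ?R")
  proof -
    have "?R = (\<Sum>l\<in>S. \<Sum>j\<in>T. \<Sum>m\<in>T. \<Sum>n\<in>T. \<Sum>k\<in>S. \<Sum>i\<in>T. D [k, l] (X m n) * X l j * X k i *
            (DD [m] [n, i, j] p q - DD [n, i, j] [m] p q))"
      by (intro sum.cong refl)
        (simp add: B_expand[OF S(1) vS T(1) vT(3)] B_expand[OF S(1) vS T(1) vT(4)] sum_distrib_left
          DD_def D_simps pderiv_var_commute right_diff_distrib sum_subtractf mult_ac)
    also have "\<dots> = ?L"
      unfolding sum.cartesian_product
      by (rule sum.reindex_bij_witness[where i = "\<lambda>(i, j, k, l, m, n). (l, j, m, n, k, i)"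
            and j = "\<lambda>(l, j, m, n, k, i). (i, j, k, l, m, n)"]) auto
    finally show ?thesis by simp
  qed
  have e5: "(\<Sum>i\<in>T. \<Sum>j\<in>T. \<Sum>k\<in>S. \<Sum>l\<in>T. \<Sum>m\<in>T. \<Sum>n\<in>T. D [k] (X i j) * X k l * X m n *
            (DD [j, l, m] [i, n] p q - DD [i, n] [j, l, m] p q)) =
     (\<Sum>i\<in>T. \<Sum>j\<in>T. \<Sum>m\<in>T. \<Sum>n\<in>T. X m n *
           (B (X i j) (pderiv_var j (pderiv_var m p)) * pderiv_var i (pderiv_var n q) -
            pderiv_var i (pderiv_var n p) * B (X i j) (pderiv_var j (pderiv_var m q))))" (is "?L = ?R")
  proof -
    have "?R = (\<Sum>i\<in>T. \<Sum>j\<in>T. \<Sum>m\<in>T. \<Sum>n\<in>T. \<Sum>k\<in>S. \<Sum>l\<in>T. D [k] (X i j) * X k l * X m n *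
            (DD [j, l, m] [i, n] p q - DD [i, n] [j, l, m] p q))"
      by (intro sum.cong refl)
        (simp add: B_expand[OF S(1) S(2) T(1) vT(3)] B_expand[OF S(1) S(2) T(1) vT(4)] sum_distrib_left
          sum_distrib_right DD_def D_simps pderiv_var_commute right_diff_distrib sum_subtractf mult_ac)
    also have "\<dots> = ?L"
      unfolding sum.cartesian_product
      by (rule sum.reindex_bij_witness[where i = "\<lambda>(i, j, k, l, m, n). (i, j, m, n, k, l)"
            and j = "\<lambda>(i, j, m, n, k, l). (i, j, k, l, m, n)"]) auto
    finally show ?thesis by simp
  qed
  show ?thesis
    unfolding pi3_def 1 2 3 4 5 e1 e2 e3 e4 e5 numeral_smul by simp
qed

end

section \<open>Bilinearity of the second and third order terms\<close>

lemma vars_add: "vars (p + q) \<subseteq> vars p \<union> vars q"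
  by (auto simp: vars_def pderiv_var_add)

lemma vars_smul: "vars (smul c p) \<subseteq> vars p"
  by (auto simp: vars_def pderiv_var_smul)

lemma vars_mult: "vars (p * q) \<subseteq> vars p \<union> vars q"
  by (auto simp: vars_def pderiv_var_mult)

text \<open>Characteristic 0 makes clearing denominators reversible; identities for
  \<open>pi2\<close> and \<open>pi3\<close> are proved after multiplication by 24 and 48.\<close>

lemma numeral_mult_cancel:
  assumes "numeral k * p = numeral k * (q :: ('i, 'f::field_char_0) mpoly)"
  shows "p = q"
proof -
  have *: "smul (inverse (numeral k)) (numeral k * u) = u" for u :: "('i, 'f) mpoly"
    by (simp add: numeral_smul flip: smul_mult_right)
  show ?thesis using arg_cong[OF assms, of "smul (inverse (numeral k))"] unfolding * .
qed

context poisson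
begin

lemma cochain_pi1: "is_cochain2 (pi1 X)"
  by (rule cochainI) (simp_all add: pi1_eq B_simps smul_add smul_smul mult.commute)

lemma cochain_pi2: "is_cochain2 (pi2 X)"
proof (rule cochainI)
  fix p p' q q' :: "('i, 'f) mpoly" and a :: 'f
  \<comment> \<open>A single index set for all arguments, so that the sums can be compared term by
    term.\<close>
  let ?T = "vars p \<union> vars p' \<union> (vars q \<union> vars q')"
  have T: "finite ?T" "vars p \<subseteq> ?T" "vars p' \<subseteq> ?T" "vars q \<subseteq> ?T" "vars q' \<subseteq> ?T"
    "vars (p + p') \<subseteq> ?T" "vars (q + q') \<subseteq> ?T" "vars (smul a p) \<subseteq> ?T" "vars (smul a q) \<subseteq> ?T"
    using vars_add[of p p'] vars_add[of q q'] vars_smul[of a p] vars_smul[of a q] by auto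
  note eqs = pi2_eq[OF T(1,2,4)] pi2_eq[OF T(1,3,4)] pi2_eq[OF T(1,2,5)] pi2_eq[OF T(1,6,4)]
    pi2_eq[OF T(1,8,4)] pi2_eq[OF T(1,2,7)] pi2_eq[OF T(1,2,9)]
  have "24 * pi2 X (p + p') q = 24 * (pi2 X p q + pi2 X p' q)"
    unfolding distrib_left eqs by (simp add: pderiv_var_add B_simps sum.distrib[symmetric] algebra_simps)
  then show "pi2 X (p + p') q = pi2 X p q + pi2 X p' q" by (rule numeral_mult_cancel)
  have "24 * pi2 X p (q + q') = 24 * (pi2 X p q + pi2 X p q')"
    unfolding distrib_left eqs by (simp add: pderiv_var_add B_simps sum.distrib[symmetric] algebra_simps)
  then show "pi2 X p (q + q') = pi2 X p q + pi2 X p q'" by (rule numeral_mult_cancel)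
  have "24 * pi2 X (smul a p) q = 24 * smul a (pi2 X p q)"
    unfolding smul_mult_right eqs smul_sum
    by (simp add: pderiv_var_smul B_simps smul_add smul_mult_left smul_mult_right)
  then show "pi2 X (smul a p) q = smul a (pi2 X p q)" by (rule numeral_mult_cancel)
  have "24 * pi2 X p (smul a q) = 24 * smul a (pi2 X p q)"
    unfolding smul_mult_right eqs smul_sum
    by (simp add: pderiv_var_smul B_simps smul_add smul_mult_left smul_mult_right)
  then show "pi2 X p (smul a q) = smul a (pi2 X p q)" by (rule numeral_mult_cancel)
qed

lemma cochain_pi3: "is_cochain2 (pi3 X)"
proof (rule cochainI)
  fix p p' q q' :: "('i, 'f) mpoly" and a :: 'f
  let ?T = "vars p \<union> vars p' \<union> (vars q \<union> vars q')"
  define S where "S = (\<Union>i\<in>?T. \<Union>j\<in>?T. vars (X i j))"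
  have S: "finite S" "(\<Union>i\<in>?T. \<Union>j\<in>?T. vars (X i j)) \<subseteq> S"
    by (auto simp: S_def)
  have T: "finite ?T" "vars p \<subseteq> ?T" "vars p' \<subseteq> ?T" "vars q \<subseteq> ?T" "vars q' \<subseteq> ?T"
    "vars (p + p') \<subseteq> ?T" "vars (q + q') \<subseteq> ?T" "vars (smul a p) \<subseteq> ?T" "vars (smul a q) \<subseteq> ?T"
    using vars_add[of p p'] vars_add[of q q'] vars_smul[of a p] vars_smul[of a q] by auto
  note eqs = pi3_eq[OF T(1,2,4) S] pi3_eq[OF T(1,3,4) S] pi3_eq[OF T(1,2,5) S] pi3_eq[OF T(1,6,4) S]
    pi3_eq[OF T(1,8,4) S] pi3_eq[OF T(1,2,7) S] pi3_eq[OF T(1,2,9) S]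
  note lin_simps = pderiv_var_add B_simps sum.distrib sum_subtractf distrib_left distrib_right
    left_diff_distrib right_diff_distrib
  note smul_simps = pderiv_var_smul B_simps smul_add smul_diff smul_mult_left smul_mult_right smul_sum
    left_diff_distrib right_diff_distrib sum_distrib_left
  have "48 * pi3 X (p + p') q = 48 * (pi3 X p q + pi3 X p' q)"
    unfolding distrib_left[of 48] eqs by (simp add: lin_simps)
  then show "pi3 X (p + p') q = pi3 X p q + pi3 X p' q" by (rule numeral_mult_cancel)
  have "48 * pi3 X p (q + q') = 48 * (pi3 X p q + pi3 X p q')"
    unfolding distrib_left[of 48] eqs by (simp add: lin_simps)
  then show "pi3 X p (q + q') = pi3 X p q + pi3 X p q'" by (rule numeral_mult_cancel)
  have "48 * pi3 X (smul a p) q = 48 * smul a (pi3 X p q)"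
    unfolding smul_mult_right[of 48] eqs by (simp add: smul_simps)
  then show "pi3 X (smul a p) q = smul a (pi3 X p q)" by (rule numeral_mult_cancel)
  have "48 * pi3 X p (smul a q) = 48 * smul a (pi3 X p q)"
    unfolding smul_mult_right[of 48] eqs by (simp add: smul_simps)
  then show "pi3 X p (smul a q) = smul a (pi3 X p q)" by (rule numeral_mult_cancel)
qed

end

subsection \<open>Evaluation on functions of an affine polynomial\<close>

text \<open>\<open>Q s\<close> plays the role of the \<open>s\<close>-th derivative of a univariate polynomial evaluated at \<open>f\<close>.\<close>

definition chain :: "('i, 'f::field_char_0) mpoly \<Rightarrow> (nat \<Rightarrow> ('i, 'f) mpoly) \<Rightarrow> bool" where
  "chain f Q \<longleftrightarrow> (\<forall>s i. pderiv_var i (Q s) = Q (Suc s) * pderiv_var i f)"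

lemma chainD: "chain f Q \<Longrightarrow> pderiv_var i (Q s) = Q (Suc s) * pderiv_var i f"
  by (simp add: chain_def)

text \<open>The constant 1 is a function of any polynomial; it specialises formulas with two chains
  to formulas with one. In the same way \<open>chain_id\<close> makes an affine factor a
  chain.\<close>

lemma chain_one: "chain f (\<lambda>s. if s = 0 then 1 else 0)"
  by (simp add: chain_def)

lemma chain_id: "chain f (\<lambda>s. if s = 0 then f else if s = 1 then 1 else 0)"
  by (simp add: chain_def)

text \<open>The s-th derivative of t q(t) is t q^(s) + s q^(s-1). For s = 0 the truncated index is
  harmless because its coefficient is 0.\<close>

lemma chain_mult:
  assumes "chain f Q"
  shows "chain f (\<lambda>s. f * Q s + of_nat s * Q (s - 1))"
  unfolding chain_def
proof (intro allI)
  fix s i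
  show "pderiv_var i (f * Q s + of_nat s * Q (s - 1)) = (f * Q (Suc s) + of_nat (Suc s) * Q (Suc s - 1)) * pderiv_var i f"
  proof (cases s)
    case 0
    then show ?thesis
      by (simp add: pderiv_var_mult chainD[OF assms] algebra_simps)
  next
    case (Suc t)
    have "pderiv_var i (of_nat s * Q t) = of_nat s * pderiv_var i (Q t)"
      by (simp only: of_nat_smul pderiv_var_smul)
    with Suc show ?thesis
      by (simp add: pderiv_var_add pderiv_var_mult[of i f] chainD[OF assms] algebra_simps)
  qed
qed

lemma chain_power: "\<exists>Q. chain f Q \<and> Q 0 = f ^ n"
proof (induction n)
  case 0
  show ?case using chain_one[of f] by (intro exI conjI) (assumption, simp)
next
  case (Suc n)
  then obtain Q where "chain f Q" "Q 0 = f ^ n" by blast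
  then show ?case using chain_mult[of f Q] by (intro exI conjI) (assumption, simp)
qed

lemma vars_chain: "chain f Q \<Longrightarrow> vars (Q s) \<subseteq> vars f"
  by (auto simp: vars_def chainD)

lemma derivation_chain:
  assumes "chain f Q" "derivation d"
  shows "d (Q s) = Q (Suc s) * d f"
  unfolding derivation_eq_sum[OF assms(2) finite_vars vars_chain[OF assms(1)]] derivation_eq_sum_vars[OF assms(2), of f]
  by (simp add: chainD[OF assms(1)] sum_distrib_left mult_ac)

section \<open>Contractions with derivatives of affine polynomials\<close>

locale poisson_vars = poisson +
  fixes T S :: "'a set"
  assumes finT: "finite T" and finS: "finite S" and TS: "T \<subseteq> S"
    and XS: "(\<Union>i\<in>T. \<Union>j\<in>T. vars (X i j)) \<subseteq> S"
begin

text \<open>\<open>T\<close> holds the variables of the test polynomials. The larger set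
  \<open>S\<close> also holds those of the X with indices in \<open>T\<close>, hence those of
  brackets of test polynomials.\<close>

definition aff :: "('a, 'b) mpoly \<Rightarrow> bool" where
  "aff f \<longleftrightarrow> affine f \<and> vars f \<subseteq> T"

text \<open>The contractions that cannot be written as iterated brackets of \<open>f\<close>, \<open>g\<close> and \<open>u\<close>.  Expanding
  the bracket in \<open>{{u, f}, g}\<close> gives \<open>hh f g u + rr f g u\<close>, so \<open>hh\<close> is eventually eliminated.\<close>

definition tt :: "('a, 'b) mpoly \<Rightarrow> ('a, 'b) mpoly \<Rightarrow> ('a, 'b) mpoly" where
  "tt f u = (\<Sum>k\<in>S. B (B (gen k) f) (pderiv_var k u))"

definition rr :: "('a, 'b) mpoly \<Rightarrow> ('a, 'b) mpoly \<Rightarrow> ('a, 'b) mpoly \<Rightarrow> ('a, 'b) mpoly" where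
  "rr f g u = (\<Sum>k\<in>S. pderiv_var k u * B (B (gen k) f) g)"

definition hh :: "('a, 'b) mpoly \<Rightarrow> ('a, 'b) mpoly \<Rightarrow> ('a, 'b) mpoly \<Rightarrow> ('a, 'b) mpoly" where
  "hh f g u = (\<Sum>k\<in>S. B (gen k) f * B (pderiv_var k u) g)"

lemma aff_varsT: "aff f \<Longrightarrow> vars f \<subseteq> T" and aff_varsS: "aff f \<Longrightarrow> vars f \<subseteq> S"
  using TS by (auto simp: aff_def)

lemma aff_pderiv: "aff f \<Longrightarrow> pderiv_var i (pderiv_var j f) = 0"
  by (simp add: aff_def affine_def)

lemma aff_B1: "aff f \<Longrightarrow> B (pderiv_var j f) u = 0" and aff_B2: "aff f \<Longrightarrow> B u (pderiv_var j f) = 0"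
  using B_chain1[of "{}" "pderiv_var j f" u] B_chain2[of "{}" "pderiv_var j f" u]
  by (simp_all add: vars_def aff_pderiv)

text \<open>A first derivative of an affine polynomial is a constant, hence passes through every
  bracket and derivative.\<close>

lemma pull:
  assumes "aff f"
  shows "B (pderiv_var j f * u) v = pderiv_var j f * B u v"
    and "B u (pderiv_var j f * v) = pderiv_var j f * B u v"
    and "pderiv_var i (pderiv_var j f * u) = pderiv_var j f * pderiv_var i u"
  by (simp_all add: B_mult1 B_mult2 pderiv_var_mult aff_B1[OF assms] aff_B2[OF assms] aff_pderiv[OF assms])

lemma B_gen_aff: "aff f \<Longrightarrow> B (gen k) f = (\<Sum>l\<in>T. pderiv_var l f * X k l)"
  using B_chain2[OF finT aff_varsT, of f] by (simp add: X)

lemma B_aff: "aff f \<Longrightarrow> aff g \<Longrightarrow> B f g = (\<Sum>m\<in>T. \<Sum>n\<in>T. pderiv_var m f * (pderiv_var n g * X m n))"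
  using B_expand[OF finT aff_varsT finT aff_varsT, of f g] by (simp add: mult_ac)

lemma B_chainR: "chain g R \<Longrightarrow> B u (R s) = R (Suc s) * B u g"
  and B_chainL: "chain g R \<Longrightarrow> B (R s) u = R (Suc s) * B g u"
  using derivation_chain[OF _ derivation_B1] derivation_chain[OF _ derivation_B2] by auto

lemma vars_B: 
  assumes "aff f" "aff g"
  shows "vars (B f g) \<subseteq> S"
proof -
  have "pderiv_var k (B f g) = 0" if "k \<notin> S" for k
  proof -
    have "pderiv_var k (X m n) = 0" if "m \<in> T" "n \<in> T" for m n
      using that \<open>k \<notin> S\<close> XS by (intro not_in_vars) blast
    then show ?thesis
      unfolding B_aff[OF assms] pderiv_var_sum pull(3)[OF assms(1)] pull(3)[OF assms(2)]
      by (intro sum.neutral ballI) simp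
  qed
  then show ?thesis by (auto simp: vars_def)
qed

lemma BB_eq: "vars u \<subseteq> S \<Longrightarrow> B (B u f) g = hh f g u + rr f g u"
  unfolding hh_def rr_def B_chain1[OF finS, of u f] B_sum1
  by (simp add: B_mult1 sum.distrib mult_ac add.commute)

text \<open>The Jacobi identity for a generator, \<open>f\<close> and \<open>g\<close>, multiplied
  by the derivative of \<open>u\<close> and summed over the generators.\<close>

lemma rr_swap: "vars u \<subseteq> S \<Longrightarrow> rr f g u = rr g f u + B u (B f g)"
  unfolding rr_def B_chain1[OF finS, of u "B f g"]
  by (subst Jacobi) (simp add: distrib_left sum.distrib)

lemma tt_uminus: "tt f (- u) = - tt f u"
  and rr_uminus: "rr f g (- u) = - rr f g u"
  and hh_uminus: "hh f g (- u) = - hh f g u"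
  by (simp_all add: tt_def rr_def hh_def pderiv_var_uminus B_simps sum_negf)

lemma tt_zero: "tt f 0 = 0" and rr_zero: "rr f g 0 = 0" and hh_zero: "hh f g 0 = 0"
  by (simp_all add: tt_def rr_def hh_def B_simps)

lemma hh_mult: "hh f (u * v) w = u * hh f v w + v * hh f u w"
  by (simp add: hh_def B_mult2 sum_distrib_left sum.distrib algebra_simps)

lemma hh_chain: "chain g R \<Longrightarrow> hh f (R s) w = R (Suc s) * hh f g w"
  by (simp add: hh_def B_chainR sum_distrib_left mult_ac)

text \<open>This and the following contractions work alike: the constants enter the brackets, where
  summation turns X into brackets of affine polynomials, and only the order of summation remains to
  be permuted.\<close>

lemma contract_tt:
  assumes "aff a" "aff b" "aff c"
  shows "(\<Sum>k\<in>S. \<Sum>l\<in>T. \<Sum>m\<in>T. \<Sum>n\<in>T.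
      B (X k l) (pderiv_var k (X m n)) * (pderiv_var l a * (pderiv_var m b * pderiv_var n c))) = tt a (B b c)"
proof -
  have "tt a (B b c) = (\<Sum>k\<in>S. \<Sum>m\<in>T. \<Sum>n\<in>T. \<Sum>l\<in>T.
      B (X k l) (pderiv_var k (X m n)) * (pderiv_var l a * (pderiv_var m b * pderiv_var n c)))"
    by (simp add: tt_def assms B_gen_aff B_aff B_sum1 B_sum2 pderiv_var_sum pull sum_distrib_left
        sum_distrib_right mult_ac)
  also have "\<dots> = (\<Sum>k\<in>S. \<Sum>l\<in>T. \<Sum>m\<in>T. \<Sum>n\<in>T.
      B (X k l) (pderiv_var k (X m n)) * (pderiv_var l a * (pderiv_var m b * pderiv_var n c)))"
    unfolding sum.cartesian_product
    by (rule sum.reindex_bij_witness[where i = "\<lambda>(k, l, m, n). (k, m, n, l)"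
          and j = "\<lambda>(k, m, n, l). (k, l, m, n)"]) auto
  finally show ?thesis by simp
qed

lemma contract_rr:
  assumes "aff a" "aff b" "aff c"
  shows "(\<Sum>l\<in>S. \<Sum>j\<in>T. \<Sum>m\<in>T. \<Sum>n\<in>T.
      pderiv_var l (X j n) * (B (X l m) v * (pderiv_var j a * (pderiv_var m b * pderiv_var n c)))) = rr b v (B a c)"
proof -
  have "rr b v (B a c) = (\<Sum>l\<in>S. \<Sum>j\<in>T. \<Sum>n\<in>T. \<Sum>m\<in>T.
      pderiv_var l (X j n) * (B (X l m) v * (pderiv_var j a * (pderiv_var m b * pderiv_var n c))))"
    by (simp add: rr_def assms B_gen_aff B_aff B_sum1 B_sum2 pderiv_var_sum pull sum_distrib_left
        sum_distrib_right mult_ac)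
  also have "\<dots> = (\<Sum>l\<in>S. \<Sum>j\<in>T. \<Sum>m\<in>T. \<Sum>n\<in>T.
      pderiv_var l (X j n) * (B (X l m) v * (pderiv_var j a * (pderiv_var m b * pderiv_var n c))))"
    unfolding sum.cartesian_product
    by (rule sum.reindex_bij_witness[where i = "\<lambda>(l, j, m, n). (l, j, n, m)"
          and j = "\<lambda>(l, j, n, m). (l, j, m, n)"]) auto
  finally show ?thesis by simp
qed

lemma contract_hh:
  assumes "aff a" "aff b" "aff c"
  shows "(\<Sum>l\<in>S. \<Sum>j\<in>T. \<Sum>m\<in>T. \<Sum>n\<in>T.
      X l j * (B (pderiv_var l (X m n)) v * (pderiv_var j a * (pderiv_var m b * pderiv_var n c)))) = hh a v (B b c)"
proof -
  have "hh a v (B b c) = (\<Sum>l\<in>S. \<Sum>m\<in>T. \<Sum>n\<in>T. \<Sum>j\<in>T.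
      X l j * (B (pderiv_var l (X m n)) v * (pderiv_var j a * (pderiv_var m b * pderiv_var n c))))"
    by (simp add: hh_def assms B_gen_aff B_aff B_sum1 B_sum2 pderiv_var_sum pull sum_distrib_left
        sum_distrib_right mult_ac)
  also have "\<dots> = (\<Sum>l\<in>S. \<Sum>j\<in>T. \<Sum>m\<in>T. \<Sum>n\<in>T.
      X l j * (B (pderiv_var l (X m n)) v * (pderiv_var j a * (pderiv_var m b * pderiv_var n c))))"
    unfolding sum.cartesian_product
    by (rule sum.reindex_bij_witness[where i = "\<lambda>(l, j, m, n). (l, m, n, j)"
          and j = "\<lambda>(l, m, n, j). (l, j, m, n)"]) auto
  finally show ?thesis by simp
qed

lemma contract_BB:
  assumes "aff a" "aff b" "aff c" "aff d"
  shows "(\<Sum>i\<in>T. \<Sum>j\<in>T. \<Sum>m\<in>T. \<Sum>n\<in>T.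
      X m n * (B (X i j) v * (pderiv_var i a * (pderiv_var j b * (pderiv_var m c * pderiv_var n d))))) = B (B a b) v * B c d"
proof -
  have "B (B a b) v * B c d = (\<Sum>i\<in>T. \<Sum>m\<in>T. \<Sum>j\<in>T. \<Sum>n\<in>T.
      X m n * (B (X i j) v * (pderiv_var i a * (pderiv_var j b * (pderiv_var m c * pderiv_var n d)))))"
    by (simp add: assms B_gen_aff B_aff B_sum1 B_sum2 pderiv_var_sum pull sum_distrib_left
        sum_distrib_right mult_ac)
  also have "\<dots> = (\<Sum>i\<in>T. \<Sum>j\<in>T. \<Sum>m\<in>T. \<Sum>n\<in>T.
      X m n * (B (X i j) v * (pderiv_var i a * (pderiv_var j b * (pderiv_var m c * pderiv_var n d)))))"
    unfolding sum.cartesian_product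
    by (rule sum.reindex_bij_witness[where i = "\<lambda>(i, j, m, n). (i, m, j, n)"
          and j = "\<lambda>(i, m, j, n). (i, j, m, n)"]) auto
  finally show ?thesis by simp
qed

lemma contract_square:
  assumes "aff a" "aff b"
  shows "(\<Sum>i\<in>T. \<Sum>j\<in>T. \<Sum>k\<in>T. \<Sum>l\<in>T.
      X i j * (X k l * (pderiv_var i a * (pderiv_var k a * (pderiv_var j b * pderiv_var l b))))) = B a b * B a b"
proof -
  have "B a b * B a b = (\<Sum>i\<in>T. \<Sum>k\<in>T. \<Sum>l\<in>T. \<Sum>j\<in>T.
      X i j * (X k l * (pderiv_var i a * (pderiv_var k a * (pderiv_var j b * pderiv_var l b)))))"
    by (simp add: assms B_gen_aff B_aff B_sum1 B_sum2 pderiv_var_sum pull sum_distrib_left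
        sum_distrib_right mult_ac)
  also have "\<dots> = (\<Sum>i\<in>T. \<Sum>j\<in>T. \<Sum>k\<in>T. \<Sum>l\<in>T.
      X i j * (X k l * (pderiv_var i a * (pderiv_var k a * (pderiv_var j b * pderiv_var l b)))))"
    unfolding sum.cartesian_product
    by (rule sum.reindex_bij_witness[where i = "\<lambda>(i, j, k, l). (i, k, l, j)"
          and j = "\<lambda>(i, k, l, j). (i, j, k, l)"]) auto
  finally show ?thesis by simp
qed

lemma contract_S: "aff a \<Longrightarrow> (\<Sum>j\<in>S. pderiv_var j a * B (B z (gen j)) v) = B (B z a) v"
  and contract_S': "aff a \<Longrightarrow> (\<Sum>j\<in>S. pderiv_var j a * B (B (gen j) z) v) = B (B a z) v"
  and contract_S'': "aff a \<Longrightarrow> (\<Sum>j\<in>S. pderiv_var j a * B (gen j) z) = B a z"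
  by (simp_all add: B_chain1[OF finS aff_varsS, of a] B_chain2[OF finS aff_varsS, of a] B_sum1 pull)

section \<open>The second and third order terms on functions of affine polynomials\<close>

lemma pi2_aff:
  assumes z: "aff z" and h: "vars h \<subseteq> S"
  shows "12 * pi2 X z h = (\<Sum>j\<in>S. B (B z (gen j)) (pderiv_var j h))"
proof -
  \<comment> \<open>The other terms contain a bracket with a first derivative of \<open>z\<close>,
    which is constant.\<close>
  have "24 * pi2 X z h = (\<Sum>i\<in>S. \<Sum>j\<in>S. 2 * (pderiv_var i z * B (X i j) (pderiv_var j h)))"
    unfolding pi2_eq[OF finS aff_varsS[OF z] h] by (simp add: aff_B1[OF z] aff_B2[OF z])
  also have "\<dots> = 2 * (\<Sum>j\<in>S. \<Sum>i\<in>S. pderiv_var i z * B (X i j) (pderiv_var j h))"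
    by (subst sum.swap) (simp add: sum_distrib_left)
  also have "\<dots> = 2 * (\<Sum>j\<in>S. B (B z (gen j)) (pderiv_var j h))"
    by (simp add: B_chain1[OF finS aff_varsS[OF z], of "gen _"] X B_sum1 pull[OF z])
  finally have "2 * (12 * pi2 X z h) = 2 * (\<Sum>j\<in>S. B (B z (gen j)) (pderiv_var j h))"
    by simp
  then show ?thesis by (rule numeral_mult_cancel)
qed

text \<open>The derivative in \<open>pi2_aff\<close> falls on \<open>f\<close>, \<open>g\<close> or
  \<open>u\<close>. In the first two cases its index closes up to an iterated bracket; in the third
  it stays open and leaves \<open>tt\<close> and \<open>rr\<close>, with a minus sign from reversing
  \<open>B z (gen j)\<close>. The factor \<open>u\<close> accommodates brackets of test
  polynomials.\<close>

lemma pi2_aff_chain: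
  assumes aff: "aff z" "aff f" "aff g" and ch: "chain f Q" "chain g R" and u: "vars u \<subseteq> S"
  shows "12 * pi2 X z (Q s * R t * u) = B (B z f) (Q (Suc s) * R t * u) + B (B z g) (Q s * R (Suc t) * u)
    - (Q s * R t * tt z u + Q (Suc s) * R t * rr z f u + Q s * R (Suc t) * rr z g u)"
proof -
  have "vars (Q s * R t * u) \<subseteq> vars (Q s) \<union> vars (R t) \<union> vars u"
    using vars_mult[of "Q s * R t" u] vars_mult[of "Q s" "R t"] by blast
  with u vars_chain[OF ch(1), of s] vars_chain[OF ch(2), of t] aff_varsS[OF aff(2)] aff_varsS[OF aff(3)]
  have "vars (Q s * R t * u) \<subseteq> S" by blast
  then have "12 * pi2 X z (Q s * R t * u) = (\<Sum>j\<in>S. B (B z (gen j)) (pderiv_var j (Q s * R t * u)))"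
    by (rule pi2_aff[OF aff(1)])
  also have "\<dots> = (\<Sum>j\<in>S. pderiv_var j f * B (B z (gen j)) (Q (Suc s) * R t * u)) +
      (\<Sum>j\<in>S. pderiv_var j g * B (B z (gen j)) (Q s * R (Suc t) * u)) +
      (\<Sum>j\<in>S. B (B z (gen j)) (Q s * R t * pderiv_var j u))"
  proof -
    have "pderiv_var j (Q s * R t * u) = pderiv_var j f * (Q (Suc s) * R t * u) +
      pderiv_var j g * (Q s * R (Suc t) * u) + Q s * R t * pderiv_var j u" for j
      by (simp add: pderiv_var_mult chainD[OF ch(1)] chainD[OF ch(2)] algebra_simps)
    then show ?thesis by (simp only: B_simps pull[OF aff(2)] pull[OF aff(3)] sum.distrib)
  qed
  also have "(\<Sum>j\<in>S. B (B z (gen j)) (Q s * R t * pderiv_var j u)) =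
      - (Q s * R t * tt z u + Q (Suc s) * R t * rr z f u + Q s * R (Suc t) * rr z g u)"
    unfolding B_anti[of z "gen _"]
    by (simp add: tt_def rr_def B_mult2 B_simps B_chainR[OF ch(1)] B_chainR[OF ch(2)] sum_distrib_left
        sum.distrib sum_negf sum_subtractf algebra_simps)
  finally show ?thesis
    by (simp only: contract_S[OF aff(2)] contract_S[OF aff(3)] diff_conv_add_uminus)
qed

lemma pi2_chain:
  assumes p: "vars p \<subseteq> S" and g: "aff g" and R: "chain g R"
  shows "24 * pi2 X p (R t) = 2 * (R (Suc (Suc t)) * rr g g p) - 2 * (R (Suc t) * tt g p) + 3 * (R (Suc (Suc t)) * hh g g p)"
proof -
  have c1: "(\<Sum>j\<in>S. pderiv_var j g * X i j) = B (gen i) g" for i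
    by (simp add: B_chain2[OF finS aff_varsS[OF g]] X)
  have c2: "(\<Sum>j\<in>S. pderiv_var j g * B (X i j) v) = B (B (gen i) g) v" for i v
    by (simp add: B_chain2[OF finS aff_varsS[OF g], of "gen _"] X B_sum1 pull[OF g])
  have c3: "(\<Sum>i\<in>S. pderiv_var i g * B (X i j) v) = - B (B (gen j) g) v" for j v
  proof -
    have "(\<Sum>i\<in>S. pderiv_var i g * B (X i j) v) = B (B g (gen j)) v"
      by (simp add: B_chain1[OF finS aff_varsS[OF g], of "gen _"] X B_sum1 pull[OF g])
    then show ?thesis using B_anti[of g "gen j"] by (simp add: B_simps)
  qed
  have "24 * pi2 X p (R t) = (\<Sum>i\<in>S. \<Sum>j\<in>S.
      2 * (pderiv_var i p * (pderiv_var j g * (R (Suc (Suc t)) * B (X i j) g))) +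
      2 * (R (Suc t) * (pderiv_var i g * B (X i j) (pderiv_var j p))) +
      3 * (R (Suc (Suc t)) * (pderiv_var j g * (X i j * B (pderiv_var i p) g))))"
    unfolding pi2_eq[OF finS p subset_trans[OF vars_chain[OF R] aff_varsS[OF g]]]
    by (simp add: chainD[OF R] B_mult2 aff_B2[OF g] B_chainR[OF R] algebra_simps)
  also have "\<dots> = (\<Sum>i\<in>S. 2 * (R (Suc (Suc t)) * (pderiv_var i p * (\<Sum>j\<in>S. pderiv_var j g * B (X i j) g))))
      + 2 * (R (Suc t) * (\<Sum>j\<in>S. \<Sum>i\<in>S. pderiv_var i g * B (X i j) (pderiv_var j p)))
      + (\<Sum>i\<in>S. 3 * (R (Suc (Suc t)) * ((\<Sum>j\<in>S. pderiv_var j g * X i j) * B (pderiv_var i p) g)))"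
    by (subst (2) sum.swap) (simp add: sum.distrib sum_distrib_left sum_distrib_right mult_ac)
  also have "\<dots> = 2 * (R (Suc (Suc t)) * rr g g p) - 2 * (R (Suc t) * tt g p) + 3 * (R (Suc (Suc t)) * hh g g p)"
    unfolding c1 c2 c3 by (simp add: rr_def tt_def hh_def sum_distrib_left sum_negf mult_ac)
  finally show ?thesis .
qed

lemma pi3_chain:
  assumes aff: "aff f" "aff g" and ch: "chain f Q" "chain g R"
  shows "48 * pi3 X (Q 0) (R 0) =
    2 * (Q 1 * R 2 * tt g (B g f) - Q 2 * R 1 * tt f (B f g)) + Q 3 * R 3 * (B f g * B f g * B f g)
    + Q 2 * R 2 * (rr f g (B g f) - rr g f (B f g))
    + (Q 1 * R 3 * hh g g (B f g) - Q 3 * R 1 * hh f f (B g f))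
    + 2 * (Q 3 * R 2 * (B (B g f) f * B f g) - Q 2 * R 3 * (B (B f g) g * B g f))"
proof -
  have v: "vars (Q 0) \<subseteq> T" "vars (R 0) \<subseteq> T"
    using vars_chain[OF ch(1), of 0] vars_chain[OF ch(2), of 0] aff_varsT[OF aff(1)] aff_varsT[OF aff(2)] by auto
  note f = chainD[OF ch(1)] chainD[OF ch(2)] B_mult2 B_mult1 pderiv_var_mult
    aff_B1[OF aff(1)] aff_B1[OF aff(2)] aff_B2[OF aff(1)] aff_B2[OF aff(2)] aff_pderiv[OF aff(1)] aff_pderiv[OF aff(2)]
    B_chainR[OF ch(1)] B_chainR[OF ch(2)] B_chainL[OF ch(1)] B_chainL[OF ch(2)] eval_nat_numeral
    sum_distrib_left sum_subtractf[symmetric] left_diff_distrib right_diff_distrib mult_ac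
  show ?thesis
    unfolding pi3_eq[OF finT v finS XS]
      contract_tt[OF aff(2,2,1), symmetric] contract_tt[OF aff(1,1,2), symmetric]
  \<comment> \<open>The five sums of \<open>pi3_eq\<close> are matched separately, each with its own
    contraction.\<close>
  proof (intro arg_cong2[where f = "(+)"] arg_cong2[where f = "(*)"] refl)
    show "(\<Sum>i\<in>T. \<Sum>j\<in>T. \<Sum>k\<in>T. \<Sum>l\<in>T. X i j * X k l *
        B (pderiv_var i (pderiv_var k (Q 0))) (pderiv_var j (pderiv_var l (R 0)))) =
       Q 3 * R 3 * (B f g * B f g * B f g)"
      unfolding contract_square[OF aff, symmetric] by (simp add: f)
  next
    show "(\<Sum>l\<in>S. \<Sum>j\<in>T. \<Sum>m\<in>T. \<Sum>n\<in>T. pderiv_var l (X j n) *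
           (pderiv_var m (pderiv_var n (Q 0)) * B (X l m) (pderiv_var j (R 0)) -
            pderiv_var m (pderiv_var n (R 0)) * B (X l m) (pderiv_var j (Q 0)))) =
      Q 2 * R 2 * (rr f g (B g f) - rr g f (B f g))"
      unfolding contract_rr[OF aff(2,1,1), symmetric] contract_rr[OF aff(1,2,2), symmetric] by (simp add: f)
  next
    show "(\<Sum>l\<in>S. \<Sum>j\<in>T. \<Sum>m\<in>T. \<Sum>n\<in>T. X l j *
           (pderiv_var m (Q 0) * B (pderiv_var l (X m n)) (pderiv_var n (pderiv_var j (R 0))) -
            pderiv_var m (R 0) * B (pderiv_var l (X m n)) (pderiv_var n (pderiv_var j (Q 0))))) =
      Q 1 * R 3 * hh g g (B f g) - Q 3 * R 1 * hh f f (B g f)"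
      unfolding contract_hh[OF aff(2,1,2), symmetric] contract_hh[OF aff(1,2,1), symmetric] by (simp add: f)
  next
    show "(\<Sum>i\<in>T. \<Sum>j\<in>T. \<Sum>m\<in>T. \<Sum>n\<in>T. X m n *
           (B (X i j) (pderiv_var j (pderiv_var m (Q 0))) * pderiv_var i (pderiv_var n (R 0)) -
            pderiv_var i (pderiv_var n (Q 0)) * B (X i j) (pderiv_var j (pderiv_var m (R 0))))) =
       Q 3 * R 2 * (B (B g f) f * B f g) - Q 2 * R 3 * (B (B f g) g * B g f)"
      unfolding contract_BB[OF aff(2,1,1,2), symmetric] contract_BB[OF aff(1,2,2,1), symmetric] by (simp add: f)
  qed (simp add: f)
qed

text \<open>For affine \<open>z\<close> only the first and fourth sums of \<open>pi3_eq\<close>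
  survive; they give the \<open>tt\<close> and \<open>hh\<close> terms.\<close>

lemma pi3_aff_chain:
  assumes aff: "aff z" "aff f" "aff g" and ch: "chain f Q" "chain g R"
  shows "48 * pi3 X z (Q 0 * R 0) =
    2 * (Q 2 * R 0 * tt f (B f z) + Q 1 * R 1 * (tt f (B g z) + tt g (B f z)) + Q 0 * R 2 * tt g (B g z))
    + (hh f (Q 2 * R 0) (B z f) + hh g (Q 1 * R 1) (B z f) + hh f (Q 1 * R 1) (B z g) + hh g (Q 0 * R 2) (B z g))"
proof -
  have v: "vars z \<subseteq> T" "vars (Q 0 * R 0) \<subseteq> T"
    using vars_chain[OF ch(1), of 0] vars_chain[OF ch(2), of 0] aff_varsT[OF aff(1)] aff_varsT[OF aff(2)]
      aff_varsT[OF aff(3)] vars_mult[of "Q 0" "R 0"] by blast+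
  have q: "pderiv_var l (pderiv_var m (Q 0 * R 0)) = pderiv_var l f * (pderiv_var m f * (Q 2 * R 0)) +
      pderiv_var l f * (pderiv_var m g * (Q 1 * R 1)) + pderiv_var l g * (pderiv_var m f * (Q 1 * R 1)) +
      pderiv_var l g * (pderiv_var m g * (Q 0 * R 2))" for l m
    by (simp add: pderiv_var_mult chainD[OF ch(1)] chainD[OF ch(2)] pderiv_var_add aff_pderiv aff
        eval_nat_numeral algebra_simps)
  show ?thesis
    unfolding pi3_eq[OF finT v finS XS] q
      contract_tt[OF aff(2,2,1), symmetric] contract_tt[OF aff(2,3,1), symmetric]
      contract_tt[OF aff(3,2,1), symmetric] contract_tt[OF aff(3,3,1), symmetric]
      contract_hh[OF aff(2,1,2), symmetric] contract_hh[OF aff(3,1,2), symmetric]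
      contract_hh[OF aff(2,1,3), symmetric] contract_hh[OF aff(3,1,3), symmetric]
    by (simp add: aff_pderiv aff_B2 aff B_simps B_mult2 distrib_left sum.distrib sum_distrib_left mult_ac)
qed

end

section \<open>The associativity defects and their cocycle property\<close>

lemma numeral_eq_smul: "numeral k * p = smul (numeral k) p"
  using numeral_smul[of k 1 p] by simp

context poisson
begin

text \<open>The coefficients of h^2 and, in \<open>defect3\<close>, of h^3 in the
  associator.\<close>

definition defect2 where "defect2 p q r = pi1 X (pi1 X p q) r - pi1 X p (pi1 X q r) - hochschild (pi2 X) p q r"

definition defect3 where "defect3 p q r = gbracket (pi1 X) (pi2 X) p q r - hochschild (pi3 X) p q r"

lemma pi1_mult: "pi1 X (p * q) r = p * pi1 X q r + pi1 X p r * q"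
  "pi1 X p (q * r) = q * pi1 X p r + pi1 X p q * r"
  by (simp_all add: pi1_eq B_mult1 B_mult2 smul_add smul_mult_left smul_mult_right)

lemma B_numeral: "B (numeral k * p) q = numeral k * B p q" "B p (numeral k * q) = numeral k * B p q"
  by (simp_all add: numeral_eq_smul B_simps)

lemma B_numeral_const: "B (numeral k) q = 0" "B p (numeral k) = 0"
  using B_numeral(1)[of k 1 q] B_numeral(2)[of p k 1] derivation_one[OF derivation_B1, of q] derivation_one[OF derivation_B2, of p]
  by simp_all

lemma defect2_24: "24 * defect2 p q r = 6 * B (B p q) r - 6 * B p (B q r) -
    (p * (24 * pi2 X q r) - 24 * pi2 X (p * q) r + 24 * pi2 X p (q * r) - 24 * pi2 X p q * r)"
proof -
  have "24 * (pi1 X (pi1 X p q) r - pi1 X p (pi1 X q r)) = 6 * B (B p q) r - 6 * B p (B q r)"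
    by (simp add: pi1_eq B_simps smul_smul right_diff_distrib numeral_eq_smul)
  then show ?thesis by (simp add: defect2_def hochschild_def algebra_simps)
qed

lemma defect3_48: "48 * defect3 p q r =
    B (24 * pi2 X p q) r - B p (24 * pi2 X q r) + 24 * pi2 X (B p q) r - 24 * pi2 X p (B q r) -
    (p * (48 * pi3 X q r) - 48 * pi3 X (p * q) r + 48 * pi3 X p (q * r) - 48 * pi3 X p q * r)"
proof -
  have "48 * gbracket (pi1 X) (pi2 X) p q r =
      B (24 * pi2 X p q) r - B p (24 * pi2 X q r) + 24 * pi2 X (B p q) r - 24 * pi2 X p (B q r)"
    by (simp add: gbracket_def pi1_eq B_simps cochain_simps[OF cochain_pi2] smul_smul right_diff_distrib
        distrib_left numeral_eq_smul)
  then show ?thesis by (simp add: defect3_def hochschild_def algebra_simps)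
qed

lemma cocycle3_defect2: "cocycle3 defect2"
  unfolding cocycle3_def
  by (intro conjI allI linI)
    (simp_all add: defect2_def hochschild_def cochain_simps[OF cochain_pi1] cochain_simps[OF cochain_pi2] pi1_mult
      smul_add smul_diff smul_mult_left smul_mult_right algebra_simps)

lemma cocycle3_defect3:
  assumes "\<And>p q r. defect2 p q r = 0"
  shows "cocycle3 defect3"
proof -
  \<comment> \<open>Second order associativity expands \<open>pi2\<close> on products; the triple
    compositions of \<open>pi1\<close> that this produces cancel among themselves.\<close>
  have *: "pi2 X (p * q) r = p * pi2 X q r + pi2 X p (q * r) - pi2 X p q * r
      - (pi1 X (pi1 X p q) r - pi1 X p (pi1 X q r))" for p q r
    using assms[of p q r] by (simp add: defect2_def hochschild_def algebra_simps)
  have pi1_mult2': "pi1 X p (q * r) = pi1 X p r * q + pi1 X p q * r" for p q r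
    by (simp add: pi1_mult(2) mult.commute)
  have "p * defect3 q r s - defect3 (p * q) r s + defect3 p (q * r) s - defect3 p q (r * s) + defect3 p q r * s = 0" for p q r s
    unfolding defect3_def gbracket_def hochschild_def
    by (simp only: * pi1_mult(1) pi1_mult2' cochain_simps[OF cochain_pi1] cochain_simps[OF cochain_pi2]
        cochain_simps[OF cochain_pi3]) (simp add: algebra_simps)
  then show ?thesis
    unfolding cocycle3_def
    by (intro conjI allI linI)
      (simp_all add: defect3_def gbracket_def hochschild_def cochain_simps[OF cochain_pi1] cochain_simps[OF cochain_pi2]
        cochain_simps[OF cochain_pi3] smul_add smul_diff smul_mult_left smul_mult_right algebra_simps)
qed

end

section \<open>Vanishing of the defects on test arguments\<close>

context poisson_vars
begin

lemma tt_chain_aff: "aff f \<Longrightarrow> chain f Q \<Longrightarrow> tt a (Q s) = Q (Suc (Suc s)) * B (B f a) f"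
  and hh_chain_aff: "aff f \<Longrightarrow> chain f Q \<Longrightarrow> hh a b (Q s) = Q (Suc (Suc s)) * (B f a * B f b)"
  and rr_chain_aff: "aff f \<Longrightarrow> chain f Q \<Longrightarrow> rr a b (Q s) = Q (Suc s) * B (B f a) b"
proof -
  assume f: "aff f" and Q: "chain f Q"
  have "tt a (Q s) = (\<Sum>k\<in>S. Q (Suc (Suc s)) * (pderiv_var k f * B (B (gen k) a) f))"
    by (simp add: tt_def chainD[OF Q] B_mult2 aff_B2[OF f] B_chainR[OF Q] mult_ac)
  then show "tt a (Q s) = Q (Suc (Suc s)) * B (B f a) f"
    by (simp add: contract_S'[OF f] flip: sum_distrib_left)
  have "hh a b (Q s) = (\<Sum>k\<in>S. Q (Suc (Suc s)) * B f b * (pderiv_var k f * B (gen k) a))"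
    by (simp add: hh_def chainD[OF Q] B_mult1 aff_B1[OF f] B_chainL[OF Q] mult_ac)
  then show "hh a b (Q s) = Q (Suc (Suc s)) * (B f a * B f b)"
    by (simp only: sum_distrib_left[symmetric] contract_S''[OF f]) (simp add: mult_ac)
  have "rr a b (Q s) = (\<Sum>k\<in>S. Q (Suc s) * (pderiv_var k f * B (B (gen k) a) b))"
    by (simp add: rr_def chainD[OF Q] mult_ac)
  then show "rr a b (Q s) = Q (Suc s) * B (B f a) b"
    by (simp add: contract_S'[OF f] flip: sum_distrib_left)
qed

lemma unit_calculus: "tt a 1 = 0" "rr a b 1 = 0" "hh a 0 u = 0"
  by (simp_all add: tt_def rr_def hh_def B_simps)

lemma hh_eq: "vars u \<subseteq> S \<Longrightarrow> hh f g u = B (B u f) g - rr f g u"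
  by (simp add: BB_eq)

lemma vars_one: "vars 1 \<subseteq> S"
  by (simp add: vars_def)

lemma pi2_diag:
  assumes aff: "aff f" "aff g" and ch: "chain f Q" "chain g R"
  shows "24 * pi2 X (Q 0) (R 0) = 2 * (Q 1 * R 2 * B (B f g) g) - 2 * (Q 2 * R 1 * B (B f g) f)
    + 3 * (Q 2 * R 2 * (B f g * B f g))"
  using pi2_chain[OF subset_trans[OF vars_chain[OF ch(1), of 0] aff_varsS[OF aff(1)]] aff(2) ch(2), of 0]
  by (simp add: tt_chain_aff[OF aff(1) ch(1)] hh_chain_aff[OF aff(1) ch(1)] rr_chain_aff[OF aff(1) ch(1)]
      eval_nat_numeral mult_ac)

lemma pi2_aff_product:
  assumes aff: "aff z" "aff f" "aff g" and ch: "chain f Q" "chain g R"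
  shows "24 * pi2 X z (Q 0 * R 0) = 2 * (B (B z f) (Q 1 * R 0) + B (B z g) (Q 0 * R 1))"
proof -
  have "24 * pi2 X z (Q 0 * R 0) = 2 * (12 * pi2 X z (Q 0 * R 0 * 1))" by simp
  then show ?thesis unfolding pi2_aff_chain[OF aff ch vars_one] by (simp add: unit_calculus)
qed

lemma pi2_aff_chain1:
  assumes aff: "aff z" "aff g" and ch: "chain g R"
  shows "24 * pi2 X z (R 0) = 2 * (R 2 * B (B z g) g)"
  using pi2_aff_product[OF aff(1,2,2) chain_one ch] by (simp add: B_chainR[OF ch] B_simps eval_nat_numeral)

lemma pi3_aff_chain1:
  assumes aff: "aff z" "aff g" and ch: "chain g R"
  shows "48 * pi3 X z (R 0) = 2 * (R 2 * tt g (B g z)) + R 3 * hh g g (B z g)"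
  using pi3_aff_chain[OF aff(1,2,2) chain_one ch] by (simp add: unit_calculus hh_chain[OF ch] eval_nat_numeral)

text \<open>Rewrite rules to a normal form in \<alpha>, its iterated brackets, \<open>rr\<close> and
  \<open>tt\<close>. Because \<alpha> commutes with itself, the Jacobi identity makes both the
  double brackets and \<open>rr\<close> symmetric in \<open>f\<close> and \<open>g\<close>.\<close>

lemma aff_facts:
  assumes aff: "aff f" "aff g" and "\<alpha> = B f g"
  shows "B f f = 0" "B f g = \<alpha>" "B g f = - \<alpha>" "B f \<alpha> = - B \<alpha> f" "B g \<alpha> = - B \<alpha> g" "B \<alpha> \<alpha> = 0"
    "B f (B \<alpha> f) = - B (B \<alpha> f) f" "B f (B \<alpha> g) = - B (B \<alpha> g) f" "B (B \<alpha> g) f = B (B \<alpha> f) g"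
    "hh f f \<alpha> = B (B \<alpha> f) f - rr f f \<alpha>" "hh f g \<alpha> = B (B \<alpha> f) g - rr f g \<alpha>"
    "hh g f \<alpha> = B (B \<alpha> f) g - rr f g \<alpha>" "rr g f \<alpha> = rr f g \<alpha>"
proof -
  have v: "vars \<alpha> \<subseteq> S" using vars_B[OF aff] assms(3) by simp
  show gf: "B g f = - \<alpha>" using B_anti[of g f] assms(3) by simp
  show fg: "B f g = \<alpha>" by (simp add: assms(3))
  show aa: "B \<alpha> \<alpha> = 0" by (rule B_self)
  show J: "B (B \<alpha> g) f = B (B \<alpha> f) g" using Jacobi[of \<alpha> g f] by (simp add: gf B_simps aa)
  show R: "rr g f \<alpha> = rr f g \<alpha>" using rr_swap[OF v, of f g] by (simp add: fg aa)
  show "hh f f \<alpha> = B (B \<alpha> f) f - rr f f \<alpha>" "hh f g \<alpha> = B (B \<alpha> f) g - rr f g \<alpha>"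
    "hh g f \<alpha> = B (B \<alpha> f) g - rr f g \<alpha>"
    by (simp_all add: hh_eq[OF v] R J)
qed (rule B_self B_anti)+

lemma defect2_diag:
  assumes aff: "aff f" "aff g" and ch: "chain f Q" "chain g R"
  shows "defect2 f (Q 0) (R 0) = 0"
proof -
  define \<alpha> where "\<alpha> = B f g"
  note facts = aff_facts[OF aff \<alpha>_def]
  \<comment> \<open>The coboundary contains the product of \<open>f\<close> and \<open>Q 0\<close>,
    which is again a function of \<open>f\<close>.\<close>
  note ch' = chain_mult[OF ch(1)]
  have "24 * defect2 f (Q 0) (R 0) = 0"
    unfolding defect2_24 pi2_diag[OF aff ch] pi2_aff_product[OF aff(1) aff ch] pi2_aff_chain1[OF aff(1,1) ch(1)]
    using pi2_diag[OF aff ch' ch(2)]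
    by (simp add: facts B_mult1 B_mult2 B_chainR[OF ch(1)] B_chainR[OF ch(2)] B_chainL[OF ch(1)] B_chainL[OF ch(2)]
        B_simps B_numeral B_numeral_const eval_nat_numeral algebra_simps)
  then show ?thesis using numeral_mult_cancel[of _ "defect2 f (Q 0) (R 0)" 0] by simp
qed

lemma defect2_swap:
  assumes aff: "aff z" "aff w" "aff g" and ch: "chain g R"
  shows "defect2 z w (R 0) = defect2 w z (R 0)"
proof -
  have J: "B (B z w) g = B (B z g) w - B (B w g) z"
    using Jacobi[of z w g] B_anti[of z "B w g"] by simp
  have wz: "B w z = - B z w" "B z (B w g) = - B (B w g) z" "B w (B z g) = - B (B z g) w"
    by (rule B_anti)+
  have id: "24 * pi2 X z w = 0" "24 * pi2 X w z = 0"
    \<comment> \<open>As functions of themselves the affine polynomials have zero second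
      derivative.\<close>
    using pi2_aff_chain1[OF aff(1,2) chain_id] pi2_aff_chain1[OF aff(2,1) chain_id] by simp_all
  have "24 * defect2 z w (R 0) = 24 * defect2 w z (R 0)"
    unfolding defect2_24 pi2_aff_chain1[OF aff(1,3) ch] pi2_aff_chain1[OF aff(2,3) ch] id
      pi2_aff_product[OF aff(1,2,3) chain_id ch, simplified] pi2_aff_product[OF aff(2,1,3) chain_id ch, simplified]
    by (simp add: wz J B_mult1 B_mult2 B_chainR[OF ch] B_simps eval_nat_numeral algebra_simps)
  then show ?thesis by (rule numeral_mult_cancel)
qed

lemma defect3_diag:
  assumes aff: "aff f" "aff g" and ch: "chain f Q" "chain g R"
  shows "defect3 f (Q 0) (R 0) = 0"
proof -
  define \<alpha> where "\<alpha> = B f g"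
  note facts = aff_facts[OF aff \<alpha>_def]
  note ch' = chain_mult[OF ch(1)]
  have v: "vars \<alpha> \<subseteq> S" using vars_B[OF aff] \<alpha>_def by simp
  have fQ: "B f (Q s) = 0" for s by (simp add: B_chainR[OF ch(1)] B_self)
  have QR: "B (Q 0) (R 0) = Q (Suc 0) * R (Suc 0) * \<alpha>"
    by (simp add: B_chainR[OF ch(2)] B_chainL[OF ch(1)] \<alpha>_def mult_ac)
  \<comment> \<open>The bracket is a product of two chains and \<alpha>; this is the case for which
    \<open>pi2_aff_chain\<close> carries a factor \<open>u\<close>.\<close>
  have pi2: "24 * pi2 X f (B (Q 0) (R 0)) = 2 * (12 * pi2 X f (Q (Suc 0) * R (Suc 0) * \<alpha>))"
    unfolding QR by simp
  have fQ2: "24 * pi2 X f (Q 0) = 0" "48 * pi3 X f (Q 0) = 0"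
    using pi2_aff_chain1[OF aff(1,1) ch(1)] pi3_aff_chain1[OF aff(1,1) ch(1)]
    by (simp_all add: B_self B_simps tt_zero hh_zero)
  have "48 * defect3 f (Q 0) (R 0) = 0"
    unfolding defect3_48 pi2_diag[OF aff ch] pi2 pi2_aff_chain[OF aff(1) aff ch v] fQ2
      pi3_chain[OF aff ch] pi3_aff_chain[OF aff(1) aff ch] fQ
    using pi3_chain[OF aff ch' ch(2)]
    by (simp add: facts B_mult1 B_mult2 B_chainR[OF ch(1)] B_chainR[OF ch(2)] B_chainL[OF ch(1)] B_chainL[OF ch(2)]
        B_simps B_numeral B_numeral_const tt_zero rr_zero hh_zero tt_uminus rr_uminus hh_uminus hh_mult
        hh_chain[OF ch(1)] hh_chain[OF ch(2)] cochain_simps[OF cochain_pi2] eval_nat_numeral algebra_simps)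
  then show ?thesis using numeral_mult_cancel[of _ "defect3 f (Q 0) (R 0)" 0] by simp
qed

lemma defect3_swap:
  assumes aff: "aff z" "aff w" "aff g" and ch: "chain g R"
  shows "defect3 z w (R 0) = defect3 w z (R 0)"
proof -
  define p \<zeta> \<beta> where "p = B z w" and "\<zeta> = B z g" and "\<beta> = B w g"
  have v: "vars p \<subseteq> S" "vars \<zeta> \<subseteq> S" "vars \<beta> \<subseteq> S"
    using vars_B aff by (simp_all add: p_def \<zeta>_def \<beta>_def)
  have b: "B z w = p" "B w z = - p" "B z g = \<zeta>" "B g z = - \<zeta>" "B w g = \<beta>" "B g w = - \<beta>"
    unfolding p_def \<zeta>_def \<beta>_def by (rule refl B_anti)+
  have swap: "B z (B \<beta> g) = - B (B \<beta> g) z" "B w (B \<zeta> g) = - B (B \<zeta> g) w" "B \<beta> \<zeta> = - B \<zeta> \<beta>"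
    by (rule B_anti)+
  \<comment> \<open>Together with \<open>rr\<close> below, these orient the Jacobi identity so that
    both sides are expressed in the same brackets of \<zeta> and \<beta>.\<close>
  have J: "B p g = B \<zeta> w - B \<beta> z" "B (B \<beta> g) z = B (B \<beta> z) g + B \<zeta> \<beta>" "B (B \<zeta> g) w = B (B \<zeta> w) g - B \<zeta> \<beta>"
    using Jacobi[of z w g] B_anti[of z \<beta>] Jacobi[of \<beta> g z] Jacobi[of \<zeta> g w] swap(3)
    by (simp_all add: b B_simps)
  have rr: "rr g w \<zeta> = rr w g \<zeta> - B \<zeta> \<beta>" "rr g z \<beta> = rr z g \<beta> + B \<zeta> \<beta>"
    using rr_swap[OF v(2), of g w] rr_swap[OF v(3), of g z] swap(3) by (simp_all add: b B_simps)
  have id: "24 * pi2 X z w = 0" "24 * pi2 X w z = 0" "48 * pi3 X z w = 0" "48 * pi3 X w z = 0"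
    using pi2_aff_chain1[OF aff(1,2) chain_id] pi2_aff_chain1[OF aff(2,1) chain_id]
      pi3_aff_chain1[OF aff(1,2) chain_id] pi3_aff_chain1[OF aff(2,1) chain_id] by simp_all
  have R: "B z (R 0) = R (Suc 0) * \<zeta>" "B w (R 0) = R (Suc 0) * \<beta>"
    by (simp_all add: B_chainR[OF ch] \<zeta>_def \<beta>_def)
  have z: "24 * pi2 X z (R (Suc 0) * \<beta>) = 2 * (B \<zeta> (R 2 * \<beta>) - (R 1 * tt z \<beta> + R 2 * rr z g \<beta>))"
  proof -
    have "24 * pi2 X z (R (Suc 0) * \<beta>) = 2 * (12 * pi2 X z ((if (0::nat) = 0 then 1 else 0) * R (Suc 0) * \<beta>))"
      by simp
    then show ?thesis
      unfolding pi2_aff_chain[OF aff(1,3,3) chain_one ch v(3)] by (simp add: \<zeta>_def B_simps eval_nat_numeral)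
  qed
  have w: "24 * pi2 X w (R (Suc 0) * \<zeta>) = 2 * (B \<beta> (R 2 * \<zeta>) - (R 1 * tt w \<zeta> + R 2 * rr w g \<zeta>))"
  proof -
    have "24 * pi2 X w (R (Suc 0) * \<zeta>) = 2 * (12 * pi2 X w ((if (0::nat) = 0 then 1 else 0) * R (Suc 0) * \<zeta>))"
      by simp
    then show ?thesis
      unfolding pi2_aff_chain[OF aff(2,3,3) chain_one ch v(2)] by (simp add: \<beta>_def B_simps eval_nat_numeral)
  qed
  \<comment> \<open>After this rewriting the \<open>pi3\<close> term with the product in its first
    slot is the same on both sides and cancels.\<close>
  have wz: "w * z = z * w" by (rule mult.commute)
  have prod: "48 * pi3 X z (w * R 0) = 2 * (R 1 * (tt w (- \<zeta>) + tt g (- p)) + w * R 2 * tt g (- \<zeta>))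
      + (hh g (R 1) p + hh w (R 1) \<zeta> + hh g (w * R 2) \<zeta>)"
    "48 * pi3 X w (z * R 0) = 2 * (R 1 * (tt z (- \<beta>) + tt g p) + z * R 2 * tt g (- \<beta>))
      + (hh g (R 1) (- p) + hh z (R 1) \<beta> + hh g (z * R 2) \<beta>)"
    using pi3_aff_chain[OF aff(1,2,3) chain_id ch] pi3_aff_chain[OF aff(2,1,3) chain_id ch]
    by (simp_all add: b unit_calculus)
  have neg: "24 * pi2 X (- p) (R 0) = - (24 * pi2 X p (R 0))"
    by (simp add: cochain_simps[OF cochain_pi2])
  have "48 * defect3 z w (R 0) = 48 * defect3 w z (R 0)"
    unfolding defect3_48 R wz pi2_aff_chain1[OF aff(1,3) ch] pi2_aff_chain1[OF aff(2,3) ch] id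
      pi3_aff_chain1[OF aff(1,3) ch] pi3_aff_chain1[OF aff(2,3) ch] z w prod b neg pi2_chain[OF v(1) aff(3) ch]
    by (simp add: b swap J rr hh_eq v B_mult1 B_mult2 B_chainR[OF ch] B_chainL[OF ch] B_simps B_numeral B_numeral_const
        tt_uminus rr_uminus hh_uminus hh_mult hh_chain[OF ch] cochain_simps[OF cochain_pi2]
        eval_nat_numeral algebra_simps)
  then show ?thesis by (rule numeral_mult_cancel)
qed

end

section \<open>Associativity on all polynomials\<close>

context poisson
begin

lemma poisson_vars_exists:
  assumes "finite T"
  shows "\<exists>S. poisson_vars B X T S"
proof -
  have "poisson_vars B X T (T \<union> (\<Union>i\<in>T. \<Union>j\<in>T. vars (X i j)))"
    by unfold_locales (use assms in auto)
  then show ?thesis by blast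
qed

lemma defect_diag:
  assumes "affine f" "affine g"
  shows "defect2 f (f ^ n) (g ^ m) = 0" and "defect3 f (f ^ n) (g ^ m) = 0"
proof -
  obtain S where "poisson_vars B X (vars f \<union> vars g) S"
    using poisson_vars_exists[of "vars f \<union> vars g"] by auto
  then interpret poisson_vars B X "vars f \<union> vars g" S .
  obtain Q R where ch: "chain f Q" "Q 0 = f ^ n" "chain g R" "R 0 = g ^ m"
    using chain_power by metis
  have aff: "aff f" "aff g" using assms by (auto simp: aff_def)
  show "defect2 f (f ^ n) (g ^ m) = 0" "defect3 f (f ^ n) (g ^ m) = 0"
    using defect2_diag[OF aff ch(1,3)] defect3_diag[OF aff ch(1,3)] ch by simp_all
qed

lemma defect_swap:
  assumes "affine f" "affine g" "affine h"
  shows "defect2 f g (h ^ m) = defect2 g f (h ^ m)" and "defect3 f g (h ^ m) = defect3 g f (h ^ m)"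
proof -
  obtain S where "poisson_vars B X (vars f \<union> vars g \<union> vars h) S"
    using poisson_vars_exists[of "vars f \<union> vars g \<union> vars h"] by auto
  then interpret poisson_vars B X "vars f \<union> vars g \<union> vars h" S .
  obtain R where ch: "chain h R" "R 0 = h ^ m"
    using chain_power by metis
  have aff: "aff f" "aff g" "aff h" using assms by (auto simp: aff_def)
  show "defect2 f g (h ^ m) = defect2 g f (h ^ m)" "defect3 f g (h ^ m) = defect3 g f (h ^ m)"
    using defect2_swap[OF aff ch(1)] defect3_swap[OF aff ch(1)] ch by simp_all
qed

lemma defect2_eq_0: "defect2 p q r = 0"
  by (rule cocycle3_eq_0[OF cocycle3_defect2]) (auto intro: defect_diag defect_swap)

lemma defect3_eq_0: "defect3 p q r = 0"
  by (rule cocycle3_eq_0[OF cocycle3_defect3[OF defect2_eq_0]]) (auto intro: defect_diag defect_swap)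

lemma deformation_pi: "deformation 3 [(*), pi1 X, pi2 X, pi3 X]"
proof -
  have "hochschild (pi1 X) p q r = 0" for p q r
    by (simp add: hochschild_def pi1_mult algebra_simps)
  moreover have "hochschild (pi2 X) p q r = pi1 X (pi1 X p q) r - pi1 X p (pi1 X q r)" for p q r
    using defect2_eq_0[of p q r] by (simp add: defect2_def)
  moreover have "hochschild (pi3 X) p q r = gbracket (pi1 X) (pi2 X) p q r" for p q r
    using defect3_eq_0[of p q r] by (simp add: defect3_def)
  ultimately show ?thesis
    using deformation_3_iff[OF cochain_pi1 cochain_pi2 cochain_pi3] by blast
qed

lemma antisymmetric_pi1: "antisymmetric (pi1 X)"
proof -
  have "smul (1/2) (B p q) = - smul (1/2) (B q p)" for p q
    using arg_cong[OF B_anti[of p q], of "smul (1/2)"] by (simp only: smul_uminus)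
  then show ?thesis unfolding antisymmetric_def pi1_eq by blast
qed

end

theorem theorem5p6:
  fixes B :: "('i, 'f::field_char_0) cochain2"
    and X :: "'i \<Rightarrow> 'i \<Rightarrow> ('i, 'f) mpoly"
  assumes "poisson_bracket B"
    and "\<And>i j. X i j = B (gen i) (gen j)"
  shows "pi1 X = (\<lambda>p q. smul (1/2) (B p q)) \<and>
     deformation 3 [(*), pi1 X, pi2 X, pi3 X] \<and>
     (\<forall>\<phi>s. deformation 3 \<phi>s \<and> take 2 \<phi>s = [(*), pi1 X] \<longrightarrow>
           (\<exists>\<phi>2 \<phi>3 \<psi>3.
              antisymmetric \<phi>2 \<and> biderivation \<phi>2 \<and>
              antisymmetric \<phi>3 \<and> biderivation \<phi>3 \<and>
              is_cochain2 \<psi>3 \<and> symmetric \<psi>3 \<and>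
              hochschild \<psi>3 = gbracket (pi1 X) \<phi>2 \<and>
              equivalent_deformations 3 \<phi>s
                [(*), pi1 X, \<lambda>p q. pi2 X p q + \<phi>2 p q, \<lambda>p q. pi3 X p q + \<phi>3 p q + \<psi>3 p q])) \<and>
     (\<forall>\<phi>2 \<phi>3 \<psi>3.
              antisymmetric \<phi>2 \<and> biderivation \<phi>2 \<and>
              antisymmetric \<phi>3 \<and> biderivation \<phi>3 \<and>
              is_cochain2 \<psi>3 \<and> symmetric \<psi>3 \<and>
              hochschild \<psi>3 = gbracket (pi1 X) \<phi>2 \<longrightarrow>
              deformation 3
                [(*), pi1 X, \<lambda>p q. pi2 X p q + \<phi>2 p q, \<lambda>p q. pi3 X p q + \<phi>3 p q + \<psi>3 p q])"
proof -
  interpret poisson B X by unfold_locales (fact assms)+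
  show ?thesis
  proof (intro conjI allI impI)
    show "pi1 X = (\<lambda>p q. smul (1/2) (B p q))" by (intro ext pi1_eq)
    show "deformation 3 [(*), pi1 X, pi2 X, pi3 X]" by (fact deformation_pi)
  next
    fix \<phi>s :: "('i, 'f) cochain2 list"
    assume \<phi>s: "deformation 3 \<phi>s \<and> take 2 \<phi>s = [(*), pi1 X]"
    then have "length \<phi>s = 4" by (simp add: deformation_def)
    then obtain \<chi>0 \<chi>1 \<chi>2 \<chi>3 where "\<phi>s = [\<chi>0, \<chi>1, \<chi>2, \<chi>3]"
      by (auto simp: length_Suc_conv eval_nat_numeral)
    with \<phi>s have eq: "\<phi>s = [(*), pi1 X, \<chi>2, \<chi>3]" by simp
    with \<phi>s have ext': "deformation 3 [(*), pi1 X, \<chi>2, \<chi>3]" by simp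
    show "\<exists>\<phi>2 \<phi>3 \<psi>3.
              antisymmetric \<phi>2 \<and> biderivation \<phi>2 \<and>
              antisymmetric \<phi>3 \<and> biderivation \<phi>3 \<and>
              is_cochain2 \<psi>3 \<and> symmetric \<psi>3 \<and>
              hochschild \<psi>3 = gbracket (pi1 X) \<phi>2 \<and>
              equivalent_deformations 3 \<phi>s
                [(*), pi1 X, \<lambda>p q. pi2 X p q + \<phi>2 p q, \<lambda>p q. pi3 X p q + \<phi>3 p q + \<psi>3 p q]"
      unfolding eq by (rule classification[OF deformation_pi ext' antisymmetric_pi1]) blast
  next
    fix \<phi>2 \<phi>3 \<psi>3 :: "('i, 'f) cochain2"
    assume "antisymmetric \<phi>2 \<and> biderivation \<phi>2 \<and> antisymmetric \<phi>3 \<and> biderivation \<phi>3 \<and>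
        is_cochain2 \<psi>3 \<and> symmetric \<psi>3 \<and> hochschild \<psi>3 = gbracket (pi1 X) \<phi>2"
    then show "deformation 3
        [(*), pi1 X, \<lambda>p q. pi2 X p q + \<phi>2 p q, \<lambda>p q. pi3 X p q + \<phi>3 p q + \<psi>3 p q]"
      using deformation_perturbation[OF deformation_pi] by blast
  qed
qed

end
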